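(* Let $C\colon y^2=f(x)$ be a hyperelliptic curve over $K$ and $(\Sigma,\mathcal R,d)$ its cluster picture, with the natural $G_K$-action. (1) If $f(x)\in\mathcal O_K[x]$ then $(\Sigma,v(c_f))$ is integral. (2) Conversely, if $(\Sigma,v(c_f))$ is integral and $G_K$ acts tamely on $\mathcal R$, then $f(x-z)\in\mathcal O_K[x]$ for some $z\in K$.
   Context: $K$ is a non-archimedean local field with ring of integers $\mathcal O_K$, finite residue field of characteristic $p\ne2$, valuation $v$ on $\bar K$ with $v(\pi)=1$ for a uniformiser $\pi$, $G_K$ the absolute Galois group. $C\colon y^2=f(x)$, $f\in K[x]$ separable of degree $2g+1$ or $2g+2$, $g\ge2$, leading coefficient $c_f$, roots $\mathcal R\subset\bar K$. Its cluster picture $\Sigma$ is the set of clusters: non-empty subsets $D\cap\mathcal R$ for discs $D=\{x\in\bar K:v(x-z)\ge d\}$; a cluster of size $>1$ (proper) has depth $d_{\mathfrak s}=\min_{r,r'\in\mathfrak s}v(r-r')$; a child of $\mathfrak s$ is a maximal cluster strictly contained in $\mathfrak s$; $r\wedge\mathfrak s$ is the smallest cluster containing $r$ and $\mathfrak s$. $G_K$ acts on clusters through $\mathcal R$. For $n\in\mathbb Z$, the pair $(\Sigma,n)$ is integral if either $n\ge0$ and $d_{\mathcal R}\ge0$, or there is a $G_K$-stable proper cluster $\mathfrak s$ with $d_{\mathfrak s}\le0$ and $n+(|\mathfrak s|-|\mathfrak t|)d_{\mathfrak s}+\sum_{r\notin\mathfrak s}d_{r\wedge\mathfrak s}\ge0$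 for some $\mathfrak t$ which is either empty or a $G_K$-stable child $\mathfrak t<\mathfrak s$ with either $|\mathfrak t|=1$ or $d_{\mathfrak t}\ge0$. *)

theory Defs
  imports "HOL-Library.Extended_Real" "HOL-Computational_Algebra.Polynomial"
          "HOL-Computational_Algebra.Primes"
begin

text \<open>The type 'a plays the role of the algebraic closure of K; K is a subset of 'a.
  v is a valuation on 'a with values in ereal (v 0 = infinity).\<close>

definition is_valuation :: "('a::field \<Rightarrow> ereal) \<Rightarrow> bool" where
  "is_valuation v \<longleftrightarrow>
     (\<forall>x. v x = \<infinity> \<longleftrightarrow> x = 0) \<and> (\<forall>x. v x \<noteq> -\<infinity>) \<and>
     (\<forall>x y. v (x * y) = v x + v y) \<and>
     (\<forall>x y. min (v x) (v y) \<le> v (x + y))"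

definition is_subfield :: "'a::field set \<Rightarrow> bool" where
  "is_subfield K \<longleftrightarrow> 0 \<in> K \<and> 1 \<in> K \<and>
     (\<forall>x\<in>K. \<forall>y\<in>K. x + y \<in> K \<and> x * y \<in> K) \<and>
     (\<forall>x\<in>K. - x \<in> K \<and> inverse x \<in> K)"

definition nonarch_local_field :: "'a::field set \<Rightarrow> ('a \<Rightarrow> ereal) \<Rightarrow> bool" where
  "nonarch_local_field K v \<longleftrightarrow>
     is_subfield K \<and> is_valuation v \<and>
     (\<forall>x\<in>K. x \<noteq> 0 \<longrightarrow> (\<exists>n::int. v x = ereal (of_int n))) \<and>
     (\<exists>\<pi>\<in>K. v \<pi> = 1) \<and>
     (\<forall>x::nat \<Rightarrow> 'a. (\<forall>n. x n \<in> K) \<longrightarrow>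
        (\<forall>M::real. \<exists>N. \<forall>m\<ge>N. \<forall>n\<ge>N. ereal M \<le> v (x m - x n)) \<longrightarrow>
        (\<exists>l\<in>K. \<forall>M::real. \<exists>N. \<forall>n\<ge>N. ereal M \<le> v (x n - l))) \<and>
     (\<exists>S. finite S \<and> S \<subseteq> K \<and> (\<forall>a\<in>K. 0 \<le> v a \<longrightarrow> (\<exists>s\<in>S. 0 < v (a - s))))"

definition residue_char :: "('a::field \<Rightarrow> ereal) \<Rightarrow> nat \<Rightarrow> bool" where
  "residue_char v p \<longleftrightarrow> prime p \<and> 0 < v (of_nat p)"

definition alg_closed_field :: "'a::field itself \<Rightarrow> bool" where
  "alg_closed_field _ \<longleftrightarrow> (\<forall>q::'a poly. 0 < degree q \<longrightarrow> (\<exists>x. poly q x = 0))"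

definition algebraic_over :: "'a::field set \<Rightarrow> bool" where
  "algebraic_over K \<longleftrightarrow> (\<forall>x::'a. \<exists>q. q \<noteq> 0 \<and> (\<forall>i. coeff q i \<in> K) \<and> poly q x = 0)"

definition galois_group :: "'a::field set \<Rightarrow> ('a \<Rightarrow> 'a) set" where
  "galois_group K = {\<sigma>. bij \<sigma> \<and> (\<forall>x y. \<sigma> (x + y) = \<sigma> x + \<sigma> y \<and> \<sigma> (x * y) = \<sigma> x * \<sigma> y)
                         \<and> (\<forall>x\<in>K. \<sigma> x = x)}"

text \<open>Wild inertia subgroup: sigma with v(sigma(x)/x - 1) > 0 for all nonzero x.\<close>
definition wild_inertia :: "'a::field set \<Rightarrow> ('a \<Rightarrow> ereal) \<Rightarrow> ('a \<Rightarrow> 'a) set" where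
  "wild_inertia K v = {\<sigma>\<in>galois_group K. \<forall>x. x \<noteq> 0 \<longrightarrow> v x < v (\<sigma> x - x)}"

definition acts_tamely :: "'a::field set \<Rightarrow> ('a \<Rightarrow> ereal) \<Rightarrow> 'a set \<Rightarrow> bool" where
  "acts_tamely K v R \<longleftrightarrow> (\<forall>\<sigma>\<in>wild_inertia K v. \<forall>r\<in>R. \<sigma> r = r)"

definition roots_of :: "'a::field poly \<Rightarrow> 'a set" where
  "roots_of f = {r. poly f r = 0}"

definition clusters :: "('a::field \<Rightarrow> ereal) \<Rightarrow> 'a poly \<Rightarrow> 'a set set" where
  "clusters v f = {c. c \<noteq> {} \<and> (\<exists>z (d::real). c = {x. ereal d \<le> v (x - z)} \<inter> roots_of f)}"

definition depth :: "('a::field \<Rightarrow> ereal) \<Rightarrow> 'a set \<Rightarrow> real" where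
  "depth v c = real_of_ereal (Min {v (r - r') | r r'. r \<in> c \<and> r' \<in> c \<and> r \<noteq> r'})"

definition is_child :: "('a::field \<Rightarrow> ereal) \<Rightarrow> 'a poly \<Rightarrow> 'a set \<Rightarrow> 'a set \<Rightarrow> bool" where
  "is_child v f t s \<longleftrightarrow> t \<in> clusters v f \<and> t \<subset> s \<and>
     \<not> (\<exists>u\<in>clusters v f. t \<subset> u \<and> u \<subset> s)"

definition cluster_wedge :: "('a::field \<Rightarrow> ereal) \<Rightarrow> 'a poly \<Rightarrow> 'a \<Rightarrow> 'a set \<Rightarrow> 'a set" where
  "cluster_wedge v f r s = (THE c. c \<in> clusters v f \<and> insert r s \<subseteq> c \<and>
     (\<forall>c'\<in>clusters v f. insert r s \<subseteq> c' \<longrightarrow> c \<subseteq> c'))"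

definition G_stable :: "('a \<Rightarrow> 'a) set \<Rightarrow> 'a set \<Rightarrow> bool" where
  "G_stable G s \<longleftrightarrow> (\<forall>\<sigma>\<in>G. \<sigma> ` s = s)"

definition integral_pair :: "'a::field set \<Rightarrow> ('a \<Rightarrow> ereal) \<Rightarrow> 'a poly \<Rightarrow> real \<Rightarrow> bool" where
  "integral_pair K v f n \<longleftrightarrow>
     (0 \<le> n \<and> 0 \<le> depth v (roots_of f)) \<or>
     (\<exists>s\<in>clusters v f. 1 < card s \<and> G_stable (galois_group K) s \<and> depth v s \<le> 0 \<and>
        (\<exists>t. (t = {} \<or> (is_child v f t s \<and> G_stable (galois_group K) t \<and>
                          (card t = 1 \<or> 0 \<le> depth v t))) \<and>
             0 \<le> n + (real (card s) - real (card t)) * depth v s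
                  + (\<Sum>r\<in>roots_of f - s. depth v (cluster_wedge v f r s))))"

definition integral_poly :: "('a::field \<Rightarrow> ereal) \<Rightarrow> 'a poly \<Rightarrow> bool" where
  "integral_poly v f \<longleftrightarrow> (\<forall>i. 0 \<le> v (coeff f i))"

end

theory Submission
  imports Defs "HOL-Algebra.Exponent"
begin

text \<open>By Gauss's lemma, \<open>c \<Prod>(X - r)\<close> is integral iff \<open>v c + \<Sum> min 0 (v r) \<ge> 0\<close>. Comparing this sum
  with the discs around \<open>0\<close> gives the first part, since completeness of \<open>K\<close> makes \<open>v\<close>, and hence
  these discs, invariant under the Galois group. For the converse one needs a centre in \<open>K\<close> for a
  stable cluster. If \<open>r\<close> is fixed by wild inertia and closer to its conjugates than to \<open>z \<in> K\<close>, then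
  \<open>u = r - z\<close> has integral valuation and the residue of \<open>u\<close> divided by an element of \<open>K\<close> of the same
  valuation lies in the residue field of \<open>K\<close>; so \<open>z\<close> can be improved, and by discreteness this
  process reaches the cluster. Wild automorphisms moving \<open>u\<close> when \<open>v u\<close> has
  denominator divisible by \<open>p\<close> are found as automorphisms over a maximal subfield whose value group
  does not contain \<open>v u\<close>.\<close>

subsection \<open>Polynomials over subfields\<close>

text \<open>Tameness is assumed only for the roots, whereas wild inertia is defined by its effect on
  the whole algebraic closure. The link is made by intermediate fields \<open>L\<close> over which
  every automorphism is wild: a separable tame root lies in \<open>L\<close>, since otherwise some
  automorphism over \<open>L\<close> moves it. Tameness enters in no other way, and this is why
  extensions of partial isomorphisms to automorphisms of the closure are developed. The claim about
  the residue rests on perfectness. If all conjugates of \<open>u\<close> are congruent to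
  \<open>u\<close> relative to its size, the minimal polynomial of \<open>u\<close> reduces, after
  scaling, to a power of one linear factor, so the scaled residue is purely inseparable over the
  finite, hence perfect, residue field. Averaging the conjugates would be the obvious way to a
  centre, but the degree may be divisible by \<open>p\<close>; this is the source of the exponents
  \<open>p ^ j\<close> throughout. Characteristic 0 and characteristic \<open>p\<close> are treated
  together, so the closure need not be separable over \<open>K\<close>.\<close>

definition polys_over :: "'a::field set \<Rightarrow> 'a poly set" where
  "polys_over L = {q. \<forall>i. coeff q i \<in> L}"

lemma
  assumes "is_subfield L"
  shows subfield_0: "0 \<in> L" and subfield_1: "1 \<in> L"
    and subfield_add: "x \<in> L \<Longrightarrow> y \<in> L \<Longrightarrow> x + y \<in> L"
    and subfield_mult: "x \<in> L \<Longrightarrow> y \<in> L \<Longrightarrow> x * y \<in> L"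
    and subfield_minus: "x \<in> L \<Longrightarrow> - x \<in> L"
    and subfield_inverse: "x \<in> L \<Longrightarrow> inverse x \<in> L"
  using assms unfolding is_subfield_def by auto

lemma subfield_diff: "is_subfield L \<Longrightarrow> x \<in> L \<Longrightarrow> y \<in> L \<Longrightarrow> x - y \<in> L"
  using subfield_add[of L x "- y"] subfield_minus[of L y] by simp

lemma subfield_divide: "is_subfield L \<Longrightarrow> x \<in> L \<Longrightarrow> y \<in> L \<Longrightarrow> x / y \<in> L"
  using subfield_mult[of L x "inverse y"] subfield_inverse[of L y] by (simp add: divide_inverse)

lemma subfield_sum: "is_subfield L \<Longrightarrow> (\<And>i. i \<in> A \<Longrightarrow> h i \<in> L) \<Longrightarrow> sum h A \<in> L"
  by (induction A rule: infinite_finite_induct) (auto intro: subfield_0 subfield_add)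

lemma subfield_power: "is_subfield L \<Longrightarrow> x \<in> L \<Longrightarrow> x ^ n \<in> L"
  by (induction n) (auto intro: subfield_1 subfield_mult)

lemma subfield_of_nat: "is_subfield L \<Longrightarrow> of_nat n \<in> L"
  by (induction n) (auto intro: subfield_0 subfield_1 subfield_add)

lemmas subfield_closed = subfield_0 subfield_1 subfield_add subfield_mult subfield_minus
  subfield_inverse subfield_diff subfield_divide subfield_power subfield_of_nat

lemma
  assumes "is_subfield L"
  shows polys_over_0: "0 \<in> polys_over L"
    and polys_over_add: "q \<in> polys_over L \<Longrightarrow> s \<in> polys_over L \<Longrightarrow> q + s \<in> polys_over L"
    and polys_over_mult: "q \<in> polys_over L \<Longrightarrow> s \<in> polys_over L \<Longrightarrow> q * s \<in> polys_over L"
    and polys_over_minus: "q \<in> polys_over L \<Longrightarrow> - q \<in> polys_over L"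
    and polys_over_smult: "c \<in> L \<Longrightarrow> q \<in> polys_over L \<Longrightarrow> smult c q \<in> polys_over L"
    and polys_over_monom: "c \<in> L \<Longrightarrow> monom c n \<in> polys_over L"
    and polys_over_pCons: "c \<in> L \<Longrightarrow> q \<in> polys_over L \<Longrightarrow> pCons c q \<in> polys_over L"
  using assms unfolding polys_over_def
  by (auto simp: coeff_mult coeff_pCons subfield_closed split: nat.splits intro!: subfield_sum)

lemma polys_over_mono: "L \<subseteq> M \<Longrightarrow> polys_over L \<subseteq> polys_over M"
  by (auto simp: polys_over_def)

lemma poly_eq_0_if_coeff_0: "(\<And>i. i \<ge> n \<Longrightarrow> coeff q i = 0) \<Longrightarrow> degree q < n \<or> q = 0"
  by (metis leading_coeff_neq_0 not_less)

lemma algebraic_overD: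
  assumes "algebraic_over K" "K \<subseteq> L"
  obtains q where "q \<noteq> 0" "q \<in> polys_over L" "poly q x = 0"
proof -
  from assms(1) obtain q where "q \<noteq> 0" "\<forall>i. coeff q i \<in> K" "poly q x = 0"
    unfolding algebraic_over_def by blast
  with assms(2) that[of q] show ?thesis by (auto simp: polys_over_def)
qed

text \<open>A homomorphism from a subring is represented by its graph, so that the union of a chain
  is again one, and polynomials over the subring are related coefficientwise to their images.\<close>

definition partial_hom :: "('a::field \<times> 'a) set \<Rightarrow> bool" where
  "partial_hom G \<longleftrightarrow> (1, 1) \<in> G \<and>
     (\<forall>a a' b b'. (a, a') \<in> G \<longrightarrow> (b, b') \<in> G \<longrightarrow> (a + b, a' + b') \<in> G \<and> (a * b, a' * b') \<in> G) \<and>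
     (\<forall>a a'. (a, a') \<in> G \<longrightarrow> (- a, - a') \<in> G) \<and>
     (\<forall>b. (0, b) \<in> G \<longrightarrow> b = 0)"

definition rel_poly :: "('a::field \<times> 'a) set \<Rightarrow> 'a poly \<Rightarrow> 'a poly \<Rightarrow> bool" where
  "rel_poly G q q' \<longleftrightarrow> (\<forall>i. (coeff q i, coeff q' i) \<in> G)"

context
  fixes G :: "('a::field \<times> 'a) set"
  assumes G: "partial_hom G"
begin

lemma partial_hom_1: "(1, 1) \<in> G"
  and partial_hom_add: "(a, a') \<in> G \<Longrightarrow> (b, b') \<in> G \<Longrightarrow> (a + b, a' + b') \<in> G"
  and partial_hom_mult: "(a, a') \<in> G \<Longrightarrow> (b, b') \<in> G \<Longrightarrow> (a * b, a' * b') \<in> G"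
  and partial_hom_minus: "(a, a') \<in> G \<Longrightarrow> (- a, - a') \<in> G"
  and partial_hom_0D: "(0, b) \<in> G \<Longrightarrow> b = 0"
  using G unfolding partial_hom_def by auto

lemma partial_hom_0: "(0, 0) \<in> G"
  using partial_hom_add[OF partial_hom_1 partial_hom_minus[OF partial_hom_1]] by simp

lemma partial_hom_unique: "(a, b) \<in> G \<Longrightarrow> (a, b') \<in> G \<Longrightarrow> b = b'"
  using partial_hom_add[of a b "- a" "- b'"] partial_hom_minus[of a b'] partial_hom_0D[of "b - b'"]
  by simp

lemma partial_hom_sum:
  "(\<And>i. i \<in> A \<Longrightarrow> (h i, h' i) \<in> G) \<Longrightarrow> (sum h A, sum h' A) \<in> G"
  by (induction A rule: infinite_finite_induct) (auto intro: partial_hom_0 partial_hom_add)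

lemma partial_hom_power: "(a, a') \<in> G \<Longrightarrow> (a ^ n, a' ^ n) \<in> G"
  by (induction n) (auto intro: partial_hom_1 partial_hom_mult)

lemma rel_poly_add: "rel_poly G q q' \<Longrightarrow> rel_poly G s s' \<Longrightarrow> rel_poly G (q + s) (q' + s')"
  and rel_poly_minus: "rel_poly G q q' \<Longrightarrow> rel_poly G (- q) (- q')"
  and rel_poly_mult: "rel_poly G q q' \<Longrightarrow> rel_poly G s s' \<Longrightarrow> rel_poly G (q * s) (q' * s')"
  and rel_poly_pCons: "(a, a') \<in> G \<Longrightarrow> rel_poly G q q' \<Longrightarrow> rel_poly G (pCons a q) (pCons a' q')"
  and rel_poly_monom: "(a, a') \<in> G \<Longrightarrow> rel_poly G (monom a n) (monom a' n)"
  and rel_poly_0: "rel_poly G 0 0"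
  unfolding rel_poly_def
  by (auto simp: coeff_mult coeff_pCons partial_hom_add partial_hom_minus partial_hom_mult partial_hom_0
      intro!: partial_hom_sum split: nat.splits)

lemma rel_poly_diff: "rel_poly G q q' \<Longrightarrow> rel_poly G s s' \<Longrightarrow> rel_poly G (q - s) (q' - s')"
  using rel_poly_add[of q q' "- s" "- s'"] rel_poly_minus[of s s'] by simp

lemma rel_poly_poly:
  assumes "rel_poly G q q'" "(x, x') \<in> G"
  shows "(poly q x, poly q' x') \<in> G"
proof -
  let ?n = "max (degree q) (degree q')"
  have "poly q x = (\<Sum>i\<le>?n. coeff q i * x ^ i)" "poly q' x' = (\<Sum>i\<le>?n. coeff q' i * x' ^ i)"
    by (auto simp: poly_altdef le_degree intro!: sum.mono_neutral_left)
  then show ?thesis using assms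
    by (auto simp: rel_poly_def intro!: partial_hom_sum partial_hom_mult partial_hom_power)
qed

text \<open>Division by a monic polynomial uses only ring operations on coefficients, so it can be
  carried out in parallel on both sides of the relation. Bounding the remainder by vanishing
  coefficients avoids a case distinction for the zero polynomial.\<close>

lemma rel_poly_division:
  assumes h: "rel_poly G h h'" "lead_coeff h = 1"
    and "\<And>i. i \<ge> n \<Longrightarrow> coeff q i = 0" "rel_poly G q q'"
  shows "\<exists>s s' t t'. rel_poly G s s' \<and> rel_poly G t t' \<and> q = s * h + t \<and> q' = s' * h' + t' \<and>
           (\<forall>i\<ge>degree h. coeff t i = 0)"
  using assms(3,4)
proof (induction n arbitrary: q q')
  case 0
  then show ?case
    by (intro exI[of _ 0] exI[of _ q] exI[of _ q']) (auto simp: rel_poly_0)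
next
  case (Suc n)
  show ?case
  proof (cases "Suc n \<le> degree h")
    case True
    then show ?thesis using Suc.prems
      by (intro exI[of _ 0] exI[of _ q] exI[of _ q']) (auto simp: rel_poly_0)
  next
    case False
    define k where "k = n - degree h"
    let ?m = "monom (coeff q n) k" and ?m' = "monom (coeff q' n) k"
    have m: "rel_poly G ?m ?m'"
      using Suc.prems(2) by (intro rel_poly_monom) (auto simp: rel_poly_def)
    have "coeff (q - ?m * h) i = 0" if "i \<ge> n" for i
    proof (cases "i = n")
      case True
      then show ?thesis using False h(2) by (simp add: coeff_monom_mult k_def)
    next
      case False
      then have "i - k > degree h" using that \<open>\<not> Suc n \<le> degree h\<close> by (simp add: k_def)
      then show ?thesis using False that Suc.prems(1)[of i]
        by (simp add: coeff_monom_mult coeff_eq_0)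
    qed
    from Suc.IH[OF this rel_poly_diff[OF Suc.prems(2) rel_poly_mult[OF m h(1)]]]
    obtain s s' t t' where st: "rel_poly G s s'" "rel_poly G t t'" "q - ?m * h = s * h + t"
      "q' - ?m' * h' = s' * h' + t'" "\<forall>i\<ge>degree h. coeff t i = 0" by blast
    show ?thesis
      using st rel_poly_add[OF st(1) m]
      by (intro exI[of _ "s + ?m"] exI[of _ "s' + ?m'"] exI[of _ t] exI[of _ t'])
         (auto simp: algebra_simps)
  qed
qed

end

text \<open>With the identity graph, related polynomials are equal polynomials over
  \<open>L\<close>, so division over \<open>L\<close> becomes a special case of the parallel
  division.\<close>

lemma partial_hom_Id_on: "is_subfield L \<Longrightarrow> partial_hom (Id_on L)"
  by (auto simp: partial_hom_def intro: subfield_closed)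

lemma rel_poly_Id_on: "rel_poly (Id_on L) q q' \<longleftrightarrow> q = q' \<and> q \<in> polys_over L"
  by (auto simp: rel_poly_def polys_over_def poly_eq_iff Id_on_iff)

lemma polys_over_division:
  assumes "is_subfield L" "h \<in> polys_over L" "lead_coeff h = 1" "q \<in> polys_over L"
  obtains s t where "s \<in> polys_over L" "t \<in> polys_over L" "q = s * h + t"
    "\<And>i. i \<ge> degree h \<Longrightarrow> coeff t i = 0"
  using rel_poly_division[OF partial_hom_Id_on[OF assms(1)], of h h "Suc (degree q)" q q] assms that
  by (auto simp: rel_poly_Id_on coeff_eq_0)

text \<open>Minimality is stated through vanishing coefficients because this is the form in which
  division delivers its remainder.\<close>

definition is_min_poly :: "'a::field set \<Rightarrow> 'a \<Rightarrow> 'a poly \<Rightarrow> bool" where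
  "is_min_poly L x m \<longleftrightarrow> m \<in> polys_over L \<and> lead_coeff m = 1 \<and> poly m x = 0 \<and>
     (\<forall>q\<in>polys_over L. poly q x = 0 \<longrightarrow> (\<forall>i\<ge>degree m. coeff q i = 0) \<longrightarrow> q = 0)"

lemma is_min_polyD:
  assumes "is_min_poly L x m"
  shows "m \<in> polys_over L" "lead_coeff m = 1" "poly m x = 0" "degree m > 0"
    "\<And>q. q \<in> polys_over L \<Longrightarrow> poly q x = 0 \<Longrightarrow> (\<And>i. i \<ge> degree m \<Longrightarrow> coeff q i = 0) \<Longrightarrow> q = 0"
proof -
  show "degree m > 0"
  proof (rule ccontr)
    assume "\<not> degree m > 0"
    then obtain c where "m = [:c:]" using degree_eq_zeroE by auto
    with assms show False by (auto simp: is_min_poly_def)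
  qed
qed (use assms in \<open>auto simp: is_min_poly_def\<close>)

lemma min_poly_exists:
  assumes L: "is_subfield L" and K: "algebraic_over K" "K \<subseteq> L"
  obtains m where "is_min_poly L x m"
proof -
  let ?P = "\<lambda>q. q \<noteq> 0 \<and> q \<in> polys_over L \<and> poly q x = 0"
  obtain q0 where "?P q0" using algebraic_overD[OF K] by metis
  then obtain q where q: "?P q" and le: "\<And>s. ?P s \<Longrightarrow> degree q \<le> degree s"
    using ex_has_least_nat[of ?P q0 degree] by blast
  define m where "m = smult (inverse (lead_coeff q)) q"
  have "is_min_poly L x m" unfolding is_min_poly_def
  proof (intro conjI ballI impI)
    show "m \<in> polys_over L" unfolding m_def using q L
      by (intro polys_over_smult subfield_inverse) (auto simp: polys_over_def)
    show "lead_coeff m = 1" "poly m x = 0" using q by (auto simp: m_def)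
    fix s assume s: "s \<in> polys_over L" "poly s x = 0" "\<forall>i\<ge>degree m. coeff s i = 0"
    have "degree m = degree q" using q by (simp add: m_def)
    then show "s = 0" using s le[of s] poly_eq_0_if_coeff_0[of "degree m" s] by force
  qed
  with that show ?thesis .
qed

lemma min_poly_dvd:
  assumes L: "is_subfield L" and m: "is_min_poly L x m" and q: "q \<in> polys_over L" "poly q x = 0"
  obtains s where "s \<in> polys_over L" "q = s * m"
proof -
  note m = is_min_polyD[OF m]
  obtain s t where st: "s \<in> polys_over L" "t \<in> polys_over L" "q = s * m + t"
    "\<And>i. i \<ge> degree m \<Longrightarrow> coeff t i = 0" using polys_over_division[OF L m(1,2) q(1)] by metis
  have "poly t x = 0" using st(3) q(2) m(3) by simp
  then have "t = 0" using st(2,4) by (intro m(5))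
  with st that show ?thesis by simp
qed

section \<open>Splitting over the algebraically closed field\<close>

lemma alg_closed_root:
  fixes q :: "'a::field poly"
  assumes "alg_closed_field TYPE('a)" "degree q > 0"
  obtains x where "poly q x = 0"
  using assms unfolding alg_closed_field_def by auto

text \<open>A list records multiplicities, which matter because minimal polynomials may be
  inseparable.\<close>

lemma alg_closed_splits:
  fixes q :: "'a::field poly"
  assumes ac: "alg_closed_field TYPE('a)"
  shows "\<exists>xs. length xs = degree q \<and> q = smult (lead_coeff q) (\<Prod>x\<leftarrow>xs. [:- x, 1:])"
proof (induction "degree q" arbitrary: q)
  case 0
  then show ?case by (intro exI[of _ "[]"]) (auto elim!: degree_eq_zeroE)
next
  case (Suc n)
  then obtain x where "poly q x = 0" using alg_closed_root[OF ac, of q] by auto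
  then obtain s where s: "q = [:- x, 1:] * s" by (auto simp: poly_eq_0_iff_dvd)
  have "s \<noteq> 0" using s Suc.hyps(2) by auto
  then have "degree q = Suc (degree s)" unfolding s by (subst degree_mult_eq) auto
  then have "n = degree s" using Suc.hyps(2) by simp
  from Suc.hyps(1)[OF this] obtain xs where
    xs: "length xs = degree s" "s = smult (lead_coeff s) (\<Prod>x\<leftarrow>xs. [:- x, 1:])" by blast
  have lc: "lead_coeff q = lead_coeff s" unfolding s by (subst lead_coeff_mult) simp
  have "q = smult (lead_coeff s) ([:- x, 1:] * (\<Prod>x\<leftarrow>xs. [:- x, 1:]))"
    by (subst s, subst xs(2)) (simp only: mult_smult_right)
  then have "q = smult (lead_coeff q) (\<Prod>x\<leftarrow>x # xs. [:- x, 1:])"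
    unfolding lc list.map prod_list.Cons .
  then show ?case using xs(1) \<open>degree q = Suc (degree s)\<close>
    by (intro exI[of _ "x # xs"] conjI) simp_all
qed

lemma poly_prod_list_linear_0_iff:
  "poly (\<Prod>x\<leftarrow>xs. [:- x, 1:]) (y::'a::field) = 0 \<longleftrightarrow> y \<in> set xs"
  by (induction xs) auto

lemma power_iterate: "(b ^ q ^ d) ^ q ^ i = (b :: 'b::monoid_mult) ^ q ^ (d + i)"
  by (simp add: power_add power_mult)

lemma coeff_prod_linear_eq_0:
  "i > length xs \<Longrightarrow> coeff (\<Prod>x\<leftarrow>xs. [:- x, 1::'b::comm_ring_1:]) i = 0"
proof (induction xs arbitrary: i)
  case (Cons x xs)
  then show ?case by (cases i) (auto simp: coeff_pCons)
qed (simp add: coeff_1)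

lemma card_gt_1I: "finite s \<Longrightarrow> a \<in> s \<Longrightarrow> b \<in> s \<Longrightarrow> a \<noteq> b \<Longrightarrow> card s > 1"
  by (metis card_le_Suc0_iff_eq One_nat_def not_less)

subsection \<open>Extension of automorphisms\<close>

text \<open>The minimal equation of a nonzero \<open>z\<close> reads
  \<open>c + z * poly s z = 0\<close>, and minimality gives \<open>c \<noteq> 0\<close>; hence the
  inverse of \<open>z\<close> is itself a polynomial in \<open>z\<close> over
  \<open>K\<close>.\<close>

lemma subring_inverse_closed:
  assumes K: "is_subfield K" "algebraic_over K" and A: "K \<subseteq> A"
    and cl: "\<And>x y. x \<in> A \<Longrightarrow> y \<in> A \<Longrightarrow> x + y \<in> A" "\<And>x y. x \<in> A \<Longrightarrow> y \<in> A \<Longrightarrow> x * y \<in> A"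
    and z: "z \<in> A"
  shows "inverse z \<in> A"
proof (cases "z = 0")
  case True
  then show ?thesis using z by simp
next
  case False
  obtain m where m: "is_min_poly K z m" using min_poly_exists[OF K(1) K(2) order_refl] .
  note m = is_min_polyD[OF m]
  obtain c s where cs: "m = pCons c s" by (cases m)
  have sK: "s \<in> polys_over K"
    unfolding polys_over_def
  proof clarify
    fix i show "coeff s i \<in> K" using m(1) cs unfolding polys_over_def
      by (metis (mono_tags, lifting) coeff_pCons_Suc mem_Collect_eq)
  qed
  have eq: "c + z * poly s z = 0" using m(3) cs by simp
  have c: "c \<noteq> 0"
  proof
    assume "c = 0"
    then have "poly s z = 0" using eq False by simp
    moreover have "coeff s i = 0" if "i \<ge> degree m" for i
      using that cs m(4) by (intro coeff_eq_0) (auto split: if_splits)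
    ultimately have "s = 0" using sK by (intro m(5)) auto
    then show False using m(4) cs by simp
  qed
  have pz: "poly q z \<in> A" if "q \<in> polys_over K" for q
    using that
  proof (induction q)
    case 0
    then show ?case using A subfield_0[OF K(1)] by auto
  next
    case (pCons a q)
    have "a \<in> K" "q \<in> polys_over K" using pCons.prems unfolding polys_over_def
       by (auto simp: coeff_pCons split: nat.splits)
    then show ?case using pCons.IH A z cl by auto
  qed
  have "inverse z = - inverse c * poly s z"
    using eq False c by (simp add: field_simps add_eq_0_iff2)
  moreover have "c \<in> K" using m(1) cs unfolding polys_over_def
    by (metis (mono_tags, lifting) coeff_pCons_0 mem_Collect_eq)
  ultimately show ?thesis using cl(2) pz[OF sK] A subfield_inverse[OF K(1)] subfield_minus[OF K(1)] 
    by (metis subsetD)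
qed

text \<open>Polynomial values suffice, without quotients, because everything is algebraic over
  \<open>K\<close>.\<close>

definition adjoin :: "'a::field set \<Rightarrow> 'a \<Rightarrow> 'a set" where
  "adjoin L y = {poly q y | q. q \<in> polys_over L}"

lemma
  assumes L: "is_subfield L" and K: "is_subfield K" "algebraic_over K" "K \<subseteq> L"
  shows subfield_adjoin: "is_subfield (adjoin L y)"
    and subset_adjoin: "L \<subseteq> adjoin L y" and in_adjoin: "y \<in> adjoin L y"
proof -
  show LA: "L \<subseteq> adjoin L y"
  proof
    fix a assume "a \<in> L"
    then have "[:a:] \<in> polys_over L" using L by (intro polys_over_pCons polys_over_0)
    then show "a \<in> adjoin L y" unfolding adjoin_def by (intro CollectI exI[of _ "[:a:]"]) auto
  qed
  have "[:0, 1:] \<in> polys_over L" using L by (intro polys_over_pCons polys_over_0 subfield_closed)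
  then show "y \<in> adjoin L y" unfolding adjoin_def by (intro CollectI exI[of _ "[:0, 1:]"]) auto
  have add: "a + b \<in> adjoin L y" if "a \<in> adjoin L y" "b \<in> adjoin L y" for a b
    using that polys_over_add[OF L] unfolding adjoin_def by clarify (metis poly_add)
  have mult: "a * b \<in> adjoin L y" if "a \<in> adjoin L y" "b \<in> adjoin L y" for a b
    using that polys_over_mult[OF L] unfolding adjoin_def by clarify (metis poly_mult)
  have "- a \<in> adjoin L y" if "a \<in> adjoin L y" for a
    using that polys_over_minus[OF L] unfolding adjoin_def by clarify (metis poly_minus)
  moreover have "inverse a \<in> adjoin L y" if "a \<in> adjoin L y" for a
    using subring_inverse_closed[OF K(1,2) _ add mult that] K(3) LA by blast
  ultimately show "is_subfield (adjoin L y)"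
    unfolding is_subfield_def using LA subfield_0[OF L] subfield_1[OF L] add mult by auto
qed

text \<open>Sending \<open>poly q x\<close> to \<open>poly q' x'\<close> is well defined: if
  \<open>poly q x = 0\<close>, dividing by \<open>m\<close> leaves a remainder that is zero by
  minimality. The parallel remainder of \<open>q'\<close> is then zero as well, since 0 is related
  only to 0, and \<open>m'\<close> kills \<open>x'\<close>.\<close>

lemma partial_hom_extend:
  assumes G: "partial_hom G"
    and m: "is_min_poly (Domain G) x m" "rel_poly G m m'" "poly m' x' = 0"
  shows "\<exists>G'. partial_hom G' \<and> G \<subseteq> G' \<and> (x, x') \<in> G'"
proof -
  define G' where "G' = {(poly q x, poly q' x') | q q'. rel_poly G q q'}"
  have "partial_hom G'" unfolding partial_hom_def
  proof (intro conjI allI impI)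
    have "rel_poly G [:1:] [:1:]" using G by (intro rel_poly_pCons rel_poly_0 partial_hom_1)
    then show "(1, 1) \<in> G'" unfolding G'_def by force
    show "(a + b, a' + b') \<in> G'" if "(a, a') \<in> G'" "(b, b') \<in> G'" for a a' b b'
      using that rel_poly_add[OF G] unfolding G'_def by clarify (metis poly_add)
    show "(a * b, a' * b') \<in> G'" if "(a, a') \<in> G'" "(b, b') \<in> G'" for a a' b b'
      using that rel_poly_mult[OF G] unfolding G'_def by clarify (metis poly_mult)
    show "(- a, - a') \<in> G'" if "(a, a') \<in> G'" for a a'
      using that rel_poly_minus[OF G] unfolding G'_def by clarify (metis poly_minus)
    fix b assume "(0, b) \<in> G'"
    then obtain q q' where q: "poly q x = 0" "b = poly q' x'" "rel_poly G q q'"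
      unfolding G'_def by auto
    obtain s s' t t' where st: "rel_poly G t t'" "q = s * m + t" "q' = s' * m' + t'"
      "\<forall>i\<ge>degree m. coeff t i = 0"
      using rel_poly_division[OF G m(2) is_min_polyD(2)[OF m(1)], of "Suc (degree q)" q q'] q(3)
      by (auto simp: coeff_eq_0)
    have "t = 0"
    proof (rule is_min_polyD(5)[OF m(1)])
      show "t \<in> polys_over (Domain G)" using st(1) by (auto simp: rel_poly_def polys_over_def)
      show "poly t x = 0" using st(2) q(1) is_min_polyD(3)[OF m(1)] by simp
    qed (use st(4) in auto)
    then have "t' = 0" using st(1) partial_hom_0D[OF G]
      by (auto simp: rel_poly_def poly_eq_iff)
    then show "b = 0" using q(2) st(3) m(3) by simp
  qed
  moreover have "G \<subseteq> G'"
  proof clarify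
    fix a a' assume "(a, a') \<in> G"
    then have "rel_poly G [:a:] [:a':]" using G by (intro rel_poly_pCons rel_poly_0)
    then show "(a, a') \<in> G'" unfolding G'_def by force
  qed
  moreover have "rel_poly G [:0, 1:] [:0, 1:]"
    using G by (intro rel_poly_pCons rel_poly_0 partial_hom_0 partial_hom_1)
  then have "(x, x') \<in> G'" unfolding G'_def by force
  ultimately show ?thesis by blast
qed

lemma subfield_Domain_partial_hom:
  assumes G: "partial_hom G" and K: "is_subfield K" "algebraic_over K" "Id_on K \<subseteq> G"
  shows "is_subfield (Domain G)"
proof -
  have KD: "K \<subseteq> Domain G" using K(3) by auto
  have add: "a + b \<in> Domain G" if "a \<in> Domain G" "b \<in> Domain G" for a b
    using that partial_hom_add[OF G] by blast
  have mult: "a * b \<in> Domain G" if "a \<in> Domain G" "b \<in> Domain G" for a b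
    using that partial_hom_mult[OF G] by blast
  have "- a \<in> Domain G" if "a \<in> Domain G" for a
    using that partial_hom_minus[OF G] by blast
  then show ?thesis unfolding is_subfield_def
    using KD subfield_0[OF K(1)] subfield_1[OF K(1)] add mult
      subring_inverse_closed[OF K(1,2) KD add mult] by auto
qed

lemma partial_hom_Union:
  assumes "C \<noteq> {}" "subset.chain A C" "\<And>G. G \<in> A \<Longrightarrow> partial_hom G"
  shows "partial_hom (\<Union>C)"
proof -
  have C: "partial_hom G" if "G \<in> C" for G using that assms(2,3) by (auto simp: subset.chain_def)
  have two: "\<exists>G\<in>C. p \<in> G \<and> q \<in> G" if pq: "p \<in> \<Union>C" "q \<in> \<Union>C" for p q
  proof -
    obtain G1 G2 where "G1 \<in> C" "p \<in> G1" "G2 \<in> C" "q \<in> G2" using pq by blast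
    moreover then have "G1 \<subseteq> G2 \<or> G2 \<subseteq> G1" using assms(2) by (meson subset_chain_def)
    ultimately show ?thesis by blast
  qed
  show ?thesis unfolding partial_hom_def
  proof (intro conjI allI impI)
    show "(1, 1) \<in> \<Union>C" using assms(1) C partial_hom_1 by blast
    show "(a + b, a' + b') \<in> \<Union>C" if "(a, a') \<in> \<Union>C" "(b, b') \<in> \<Union>C" for a a' b b'
      using two[OF that] C partial_hom_add by (meson UnionI)
    show "(a * b, a' * b') \<in> \<Union>C" if "(a, a') \<in> \<Union>C" "(b, b') \<in> \<Union>C" for a a' b b'
      using two[OF that] C partial_hom_mult by (meson UnionI)
    show "(- a, - a') \<in> \<Union>C" if "(a, a') \<in> \<Union>C" for a a'
      using that C partial_hom_minus by (meson UnionE UnionI)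
    show "b = 0" if "(0, b) \<in> \<Union>C" for b
      using that C partial_hom_0D by (meson UnionE)
  qed
qed

lemma partial_hom_extend_total:
  fixes G0 :: "('a::field \<times> 'a) set"
  assumes ac: "alg_closed_field TYPE('a)"
    and G0: "partial_hom G0" and K: "is_subfield K" "algebraic_over K" "Id_on K \<subseteq> G0"
  obtains G where "partial_hom G" "G0 \<subseteq> G" "Domain G = UNIV"
proof -
  let ?A = "{G. partial_hom G \<and> G0 \<subseteq> G}"
  have "\<exists>G\<in>?A. \<forall>X\<in>?A. G \<subseteq> X \<longrightarrow> X = G"
  proof (rule subset_Zorn_nonempty)
    show "?A \<noteq> {}" using G0 by auto
    fix C assume C: "C \<noteq> {}" "subset.chain ?A C"
    then have "partial_hom (\<Union>C)" by (rule partial_hom_Union) auto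
    moreover have "G0 \<subseteq> \<Union>C" using C unfolding subset_chain_def by blast
    ultimately show "\<Union>C \<in> ?A" by simp
  qed
  then obtain G where G: "partial_hom G" "G0 \<subseteq> G"
    and max: "\<And>X. partial_hom X \<Longrightarrow> G0 \<subseteq> X \<Longrightarrow> G \<subseteq> X \<Longrightarrow> X = G" by auto
  have KG: "Id_on K \<subseteq> G" using G(2) K(3) by auto
  have "x \<in> Domain G" for x
  proof -
    have KD: "K \<subseteq> Domain G" using KG by auto
    obtain m where m: "is_min_poly (Domain G) x m"
      using min_poly_exists[OF subfield_Domain_partial_hom[OF G(1) K(1,2) KG] K(2) KD] .
    have "\<forall>i. \<exists>b. (coeff m i, b) \<in> G" using is_min_polyD(1)[OF m] by (auto simp: polys_over_def)
    then obtain b where b: "\<And>i. (coeff m i, b i) \<in> G" by metis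
    have b0: "b i = 0" if "i > degree m" for i
      using b[of i] that partial_hom_0D[OF G(1)] by (simp add: coeff_eq_0)
    define m' where "m' = Abs_poly b"
    have cm': "coeff m' = b" unfolding m'_def
      by (rule coeff_Abs_poly[where n = "degree m"]) (use b0 in auto)
    \<comment> \<open>The transported polynomial keeps its leading coefficient 1, hence has positive
      degree and a root to which \<open>x\<close> can be sent.\<close>
    have "b (degree m) = 1"
      using b[of "degree m"] is_min_polyD(2)[OF m] partial_hom_unique[OF G(1) _ partial_hom_1[OF G(1)]]
      by simp
    then have "degree m' \<ge> degree m" using cm' by (intro le_degree) auto
    then obtain x' where "poly m' x' = 0"
      using is_min_polyD(4)[OF m] alg_closed_root[OF ac, of m'] by auto
    moreover have "rel_poly G m m'" using b cm' by (auto simp: rel_poly_def)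
    ultimately obtain G' where "partial_hom G'" "G \<subseteq> G'" "(x, x') \<in> G'"
      using partial_hom_extend[OF G(1) m] by blast
    with max[of G'] G(2) show ?thesis by auto
  qed
  with G that show ?thesis by blast
qed

text \<open>The identity of \<open>L\<close> extends by \<open>y\<close> going to \<open>y'\<close>,
  and then to the whole closure. Surjectivity follows from injectivity: the map permutes the finite
  root set of every nonzero polynomial over \<open>L\<close>.\<close>

lemma conjugate_by_automorphism:
  fixes y :: "'a::field"
  assumes ac: "alg_closed_field TYPE('a)" and K: "is_subfield K" "algebraic_over K"
    and L: "is_subfield L" "K \<subseteq> L" and m: "is_min_poly L y m" "poly m y' = 0"
  obtains \<sigma> where "\<sigma> \<in> galois_group L" "\<sigma> y = y'"
proof -
  have "rel_poly (Id_on L) m m" using is_min_polyD(1)[OF m(1)] by (simp add: rel_poly_Id_on)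
  then obtain G1 where G1: "partial_hom G1" "Id_on L \<subseteq> G1" "(y, y') \<in> G1"
    using partial_hom_extend[OF partial_hom_Id_on[OF L(1)], of y m m y'] m by auto
  then have "Id_on K \<subseteq> G1" using L(2) by auto
  then obtain G where G: "partial_hom G" "G1 \<subseteq> G" "Domain G = UNIV"
    using partial_hom_extend_total[OF ac G1(1) K] by metis
  have "\<forall>x. \<exists>b. (x, b) \<in> G" using G(3) by auto
  then obtain \<sigma> where \<sigma>: "\<And>x. (x, \<sigma> x) \<in> G" by metis
  have \<sigma>I: "\<sigma> x = b" if "(x, b) \<in> G" for x b
    using partial_hom_unique[OF G(1)] that \<sigma> by blast
  have add: "\<sigma> (a + b) = \<sigma> a + \<sigma> b" and mult: "\<sigma> (a * b) = \<sigma> a * \<sigma> b" and neg: "\<sigma> (- a) = - \<sigma> a" for a b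
    using \<sigma> partial_hom_add[OF G(1)] partial_hom_mult[OF G(1)] partial_hom_minus[OF G(1)]
    by (auto intro!: \<sigma>I)
  have one: "\<sigma> 1 = 1" by (intro \<sigma>I partial_hom_1[OF G(1)])
  have fixL: "\<sigma> a = a" if "a \<in> L" for a using that G1(2) G(2) by (intro \<sigma>I) auto
  have zero: "a = 0" if "\<sigma> a = 0" for a
  proof (rule ccontr)
    assume "a \<noteq> 0"
    then have "1 = \<sigma> a * \<sigma> (inverse a)" using one mult[of a "inverse a"] by simp
    then show False using that by simp
  qed
  have inj: "inj \<sigma>"
  proof (rule injI)
    fix a b assume "\<sigma> a = \<sigma> b"
    then have "\<sigma> (a + - b) = 0" by (simp only: add neg) simp
    then show "a = b" using zero by force
  qed
  have "surj \<sigma>" unfolding surj_def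
  proof
    fix b
    obtain q where q: "q \<noteq> 0" "q \<in> polys_over L" "poly q b = 0"
      using algebraic_overD[OF K(2) L(2)] by metis
    have "poly q (\<sigma> x) = \<sigma> (poly q x)" for x
    proof -
      have "rel_poly G q q" using q(2) G1(2) G(2) by (auto simp: rel_poly_def polys_over_def)
      then show ?thesis using rel_poly_poly[OF G(1) _ \<sigma>] \<sigma>I by metis
    qed
    moreover have "\<sigma> 0 = 0" by (rule fixL) (rule subfield_0[OF L(1)])
    ultimately have "\<sigma> ` {x. poly q x = 0} \<subseteq> {x. poly q x = 0}" by auto
    then have "\<sigma> ` {x. poly q x = 0} = {x. poly q x = 0}"
      using poly_roots_finite[OF q(1)] inj by (intro endo_inj_surj) (auto intro: inj_on_subset)
    with q(3) show "\<exists>x. b = \<sigma> x" by blast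
  qed
  with inj add mult fixL have "\<sigma> \<in> galois_group L" unfolding galois_group_def bij_def by auto
  moreover have "\<sigma> y = y'" using G1(3) G(2) by (intro \<sigma>I) auto
  ultimately show ?thesis by (rule that)
qed

text \<open>The factorisation of \<open>q\<close> expresses that \<open>y\<close> is separable over \<open>K\<close>.\<close>

lemma separable_moved:
  fixes y :: "'a::field"
  assumes ac: "alg_closed_field TYPE('a)" and K: "is_subfield K" "algebraic_over K"
    and L: "is_subfield L" "K \<subseteq> L" and q: "q \<in> polys_over K" "q = [:- y, 1:] * g" "poly g y \<noteq> 0"
    and y: "y \<notin> L"
  obtains \<sigma> where "\<sigma> \<in> galois_group L" "\<sigma> y \<noteq> y"
proof -
  obtain m where m: "is_min_poly L y m" using min_poly_exists[OF L(1) K(2) L(2)] .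
  have "q \<in> polys_over L" "poly q y = 0" using q polys_over_mono[OF L(2)] by auto
  then obtain s where s: "q = s * m" using min_poly_dvd[OF L(1) m] by blast
  obtain h where h: "m = [:- y, 1:] * h" using is_min_polyD(3)[OF m] by (auto simp: poly_eq_0_iff_dvd)
  have "[:- y, 1:] * g = [:- y, 1:] * (s * h)" using q(2) s h by (metis mult.left_commute)
  then have "g = s * h" by (simp only: mult_cancel_left) simp
  then have hy: "poly h y \<noteq> 0" using q(3) by auto
  \<comment> \<open>A constant cofactor would make \<open>m\<close> equal to \<open>X - y\<close>,
    whose constant coefficient puts \<open>y\<close> into \<open>L\<close>.\<close>
  have "degree h > 0"
  proof (rule ccontr)
    assume "\<not> degree h > 0"
    then obtain c where c: "h = [:c:]" using degree_eq_zeroE by auto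
    then have "c \<noteq> 0" using hy by auto
    then have "c = 1" using is_min_polyD(2)[OF m] unfolding h c by simp
    then have "coeff m 0 = - y" using h c by simp
    then have "- y \<in> L" using is_min_polyD(1)[OF m] by (auto simp: polys_over_def dest: spec[of _ 0])
    then show False using y subfield_minus[OF L(1), of "- y"] by simp
  qed
  then obtain y' where y': "poly h y' = 0" using alg_closed_root[OF ac] by blast
  then have "poly m y' = 0" "y' \<noteq> y" using h hy by auto
  with conjugate_by_automorphism[OF ac K L m] that show ?thesis by metis
qed

subsection \<open>Non-archimedean absolute values\<close>

locale nonarch_abs =
  fixes N :: "'a::field \<Rightarrow> real"
  assumes N_eq_0_iff [simp]: "N x = 0 \<longleftrightarrow> x = 0" and N_nonneg [simp]: "0 \<le> N x"
    and N_mult: "N (x * y) = N x * N y" and N_add: "N (x + y) \<le> max (N x) (N y)"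
begin

lemma N_0 [simp]: "N 0 = 0" by simp

lemma N_pos [simp]: "N x > 0 \<longleftrightarrow> x \<noteq> 0"
  using N_nonneg[of x] N_eq_0_iff[of x] by linarith

lemma N_1 [simp]: "N 1 = 1"
  using N_mult[of 1 1] N_eq_0_iff[of 1] by simp

lemma N_minus [simp]: "N (- x) = N x"
proof -
  have "N (- 1) * N (- 1) = 1" using N_mult[of "- 1" "- 1"] by simp
  then have "N (- 1) = 1" using N_nonneg[of "- 1"] by (metis abs_of_nonneg abs_square_eq_1 power2_eq_square)
  then show ?thesis using N_mult[of "- 1" x] by simp
qed

lemma N_diff: "N (x - y) \<le> max (N x) (N y)"
  using N_add[of x "- y"] by simp

lemma N_diff_commute: "N (x - y) = N (y - x)"
  using N_minus[of "x - y"] by (simp del: N_minus)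

lemma N_power: "N (x ^ n) = N x ^ n"
  by (induction n) (auto simp: N_mult)

lemma N_inverse: "N (inverse x) = inverse (N x)"
proof (cases "x = 0")
  case False
  then have "N x * N (inverse x) = 1" using N_mult[of x "inverse x"] by simp
  then show ?thesis by (metis inverse_unique)
qed simp

lemma N_divide: "N (x / y) = N x / N y"
  by (simp add: divide_inverse N_mult N_inverse)

lemma N_add_le: "N x \<le> B \<Longrightarrow> N y \<le> B \<Longrightarrow> N (x + y) \<le> B"
  and N_add_less: "N x < B \<Longrightarrow> N y < B \<Longrightarrow> N (x + y) < B"
  and N_diff_le: "N x \<le> B \<Longrightarrow> N y \<le> B \<Longrightarrow> N (x - y) \<le> B"
  and N_diff_less: "N x < B \<Longrightarrow> N y < B \<Longrightarrow> N (x - y) < B"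
  using N_add[of x y] N_diff[of x y] by auto

lemma N_triangle_less: "N (x - y) < B \<Longrightarrow> N (y - z) < B \<Longrightarrow> N (x - z) < B"
  using N_add[of "x - y" "y - z"] by auto

lemma N_add_eq: "N y < N x \<Longrightarrow> N (x + y) = N x"
  using N_add[of x y] N_diff[of "x + y" y] by (auto simp: max_def split: if_splits)

lemma N_eq_if_close: "N (x - y) < N x \<Longrightarrow> N y = N x"
  using N_add_eq[of "y - x" x] by (simp add: N_diff_commute)

lemma N_sum_le: "0 \<le> B \<Longrightarrow> (\<And>i. i \<in> A \<Longrightarrow> N (h i) \<le> B) \<Longrightarrow> N (sum h A) \<le> B"
  by (induction A rule: infinite_finite_induct) (auto intro!: N_add_le)

lemma N_sum_less: "0 < B \<Longrightarrow> (\<And>i. i \<in> A \<Longrightarrow> N (h i) < B) \<Longrightarrow> N (sum h A) < B"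
  by (induction A rule: infinite_finite_induct) (auto intro!: N_add_less)

lemma N_of_nat_le: "N (of_nat n) \<le> 1"
  by (induction n) (auto intro!: N_add_le)

lemma N_of_int_le: "N (of_int n) \<le> 1"
  by (cases n rule: int_cases) (auto simp: N_of_nat_le simp del: of_nat_Suc)

text \<open>Terms of different absolute values cannot cancel: when one term is added, the larger of
  the two values survives. This determines the values occurring in an extension by a root.\<close>

lemma N_sum_distinct:
  assumes "finite I" "\<And>i j. i \<in> I \<Longrightarrow> j \<in> I \<Longrightarrow> i \<noteq> j \<Longrightarrow> h i \<noteq> 0 \<Longrightarrow> N (h i) \<noteq> N (h j)"
    "sum h I \<noteq> 0"
  shows "\<exists>i\<in>I. h i \<noteq> 0 \<and> N (sum h I) = N (h i)"
  using assms
proof (induction I rule: finite_induct)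
  case (insert k I)
  show ?case
  proof (cases "sum h I = 0 \<or> h k = 0")
    case True
    then show ?thesis
    proof
      assume "sum h I = 0"
      then show ?thesis using insert.prems(2) insert.hyps by (intro bexI[of _ k]) auto
    next
      assume "h k = 0"
      then have "sum h (insert k I) = sum h I" using insert.hyps by simp
      moreover have "\<exists>i\<in>I. h i \<noteq> 0 \<and> N (sum h I) = N (h i)"
        using insert.prems(2) calculation by (intro insert.IH insert.prems(1)) auto
      ultimately show ?thesis by auto
    qed
  next
    case False
    then obtain i where i: "i \<in> I" "h i \<noteq> 0" "N (sum h I) = N (h i)"
      using insert.IH insert.prems(1) by (metis insertCI)
    moreover have "i \<noteq> k" using i insert.hyps by auto
    ultimately have "N (h k) \<noteq> N (sum h I)" using insert.prems(1)[of i k] by simp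
    then consider "N (h k) < N (sum h I)" | "N (sum h I) < N (h k)" by linarith
    then show ?thesis
    proof cases
      case 1
      then have "N (sum h (insert k I)) = N (h i)"
        using N_add_eq[OF 1] insert.hyps i by (simp add: add.commute)
      with i show ?thesis by blast
    next
      case 2
      then have "N (sum h (insert k I)) = N (h k)"
        using N_add_eq[OF 2] insert.hyps by simp
      with False show ?thesis by blast
    qed
  qed
qed simp

end

section \<open>Linear independence over a complete subfield\<close>

locale complete_subfield = nonarch_abs N for N :: "'a::field \<Rightarrow> real" +
  fixes K :: "'a set"
  assumes subfield: "is_subfield K"
    and complete: "\<And>x. (\<And>n::nat. x n \<in> K) \<Longrightarrow>
      (\<And>e. e > 0 \<Longrightarrow> \<exists>M. \<forall>m\<ge>M. \<forall>n\<ge>M. N (x m - x n) < e) \<Longrightarrow>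
      \<exists>l\<in>K. \<forall>e>0. \<forall>\<^sub>F n in sequentially. N (x n - l) < e"
begin

text \<open>The bound \<open>C\<close> makes the coordinates of any sequence in the span approaching
  \<open>y\<close> Cauchy; their limits in \<open>K\<close> would express \<open>y\<close> through
  the \<open>e i\<close>. In other words, the span is closed.\<close>

lemma distance_to_span_pos:
  fixes e :: "nat \<Rightarrow> 'a"
  assumes C: "C > 0" "\<And>a i. (\<And>i. i < n \<Longrightarrow> a i \<in> K) \<Longrightarrow> i < n \<Longrightarrow> N (a i) \<le> C * N (\<Sum>i<n. a i * e i)"
    and y: "\<And>a. (\<And>i. i < n \<Longrightarrow> a i \<in> K) \<Longrightarrow> y \<noteq> (\<Sum>i<n. a i * e i)"
  shows "\<exists>\<delta>>0. \<forall>a. (\<forall>i<n. a i \<in> K) \<longrightarrow> \<delta> \<le> N (y - (\<Sum>i<n. a i * e i))"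
proof (rule ccontr)
  assume "\<not> ?thesis"
  then have "\<exists>a. (\<forall>i<n. a i \<in> K) \<and> N (y - (\<Sum>i<n. a i * e i)) < \<delta>" if "\<delta> > 0" for \<delta>
    using that by (force simp: not_le)
  then have "\<forall>k. \<exists>a. (\<forall>i<n. a i \<in> K) \<and> N (y - (\<Sum>i<n. a i * e i)) < inverse (real (Suc k))"
    by simp
  then obtain A where A: "\<And>k i. i < n \<Longrightarrow> A k i \<in> K"
    and Ay: "\<And>k. N (y - (\<Sum>i<n. A k i * e i)) < inverse (real (Suc k))" by metis
  define w where "w k = (\<Sum>i<n. A k i * e i)" for k
  have near: "N (y - w k) < \<epsilon>" if "inverse (real (Suc M)) < \<epsilon>" "k \<ge> M" for M k \<epsilon>
  proof -
    have "inverse (real (Suc k)) \<le> inverse (real (Suc M))" using that(2) by (simp add: le_imp_inverse_le)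
    then show ?thesis using Ay[of k] that(1) unfolding w_def by linarith
  qed
  have "\<exists>l\<in>K. \<forall>\<epsilon>>0. \<forall>\<^sub>F k in sequentially. N (A k i - l) < \<epsilon>" if i: "i < n" for i
  proof (rule complete)
    fix \<epsilon> :: real assume "\<epsilon> > 0"
    then obtain M where M: "inverse (real (Suc M)) < \<epsilon> / C"
      using reals_Archimedean[of "\<epsilon> / C"] C(1) by auto
    have "N (A k i - A l i) < \<epsilon>" if "k \<ge> M" "l \<ge> M" for k l
    proof -
      have "N (A k i - A l i) \<le> C * N (\<Sum>i<n. (A k i - A l i) * e i)"
        using i A subfield by (intro C(2)) (auto intro: subfield_diff)
      also have "(\<Sum>i<n. (A k i - A l i) * e i) = w k - w l"
        by (simp add: w_def algebra_simps sum_subtractf)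
      also have "N (w k - w l) < \<epsilon> / C"
        using near[OF M that(1)] near[OF M that(2)] N_triangle_less[of "w k" y "\<epsilon> / C" "w l"] N_diff_commute[of "w k" y]
        by simp
      then have "C * N (w k - w l) < \<epsilon>" using C(1) by (simp add: field_simps)
      finally show ?thesis .
    qed
    then show "\<exists>M. \<forall>k\<ge>M. \<forall>l\<ge>M. N (A k i - A l i) < \<epsilon>" by blast
  qed (use A i in auto)
  then obtain l where l: "\<And>i. i < n \<Longrightarrow> l i \<in> K"
    and lim: "\<And>i \<epsilon>. i < n \<Longrightarrow> \<epsilon> > 0 \<Longrightarrow> \<forall>\<^sub>F k in sequentially. N (A k i - l i) < \<epsilon>" by metis
  define D where "D = 1 + (\<Sum>i<n. N (e i))"
  have D: "D > 0" unfolding D_def by (simp add: add_pos_nonneg sum_nonneg)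
  have eD: "N (e i) \<le> D" if "i < n" for i
  proof -
    have "N (e i) \<le> (\<Sum>i<n. N (e i))" using that by (intro member_le_sum) auto
    then show ?thesis unfolding D_def by simp
  qed
  have "N (y - (\<Sum>i<n. l i * e i)) < \<epsilon>" if \<epsilon>: "\<epsilon> > 0" for \<epsilon>
  proof -
    have "\<forall>\<^sub>F k in sequentially. \<forall>i\<in>{..<n}. N (A k i - l i) < \<epsilon> / D"
      using lim[of _ "\<epsilon> / D"] \<epsilon> D by (intro eventually_ball_finite) auto
    moreover obtain M where M: "inverse (real (Suc M)) < \<epsilon>" using reals_Archimedean[OF \<epsilon>] by auto
    then have "\<forall>\<^sub>F k in sequentially. N (y - w k) < \<epsilon>"
      using near[OF M] by (auto simp: eventually_sequentially)
    ultimately have "\<forall>\<^sub>F k in sequentially. (\<forall>i\<in>{..<n}. N (A k i - l i) < \<epsilon> / D) \<and> N (y - w k) < \<epsilon>"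
      by (rule eventually_conj)
    then obtain k where k: "\<And>i. i < n \<Longrightarrow> N (A k i - l i) < \<epsilon> / D" "N (y - w k) < \<epsilon>"
      using eventually_happens'[OF sequentially_bot] by fastforce
    have "N ((A k i - l i) * e i) < \<epsilon>" if "i < n" for i
    proof -
      have "N ((A k i - l i) * e i) \<le> N (A k i - l i) * D"
        using eD[OF that] by (simp add: N_mult mult_left_mono)
      also have "\<dots> < \<epsilon>" using k(1)[OF that] D by (simp add: field_simps)
      finally show ?thesis .
    qed
    then have "N (\<Sum>i<n. (A k i - l i) * e i) < \<epsilon>" using \<epsilon> by (intro N_sum_less) auto
    also have "(\<Sum>i<n. (A k i - l i) * e i) = w k - (\<Sum>i<n. l i * e i)"
      by (simp add: w_def algebra_simps sum_subtractf)
    finally show ?thesis using k(2) N_triangle_less by blast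
  qed
  then have "N (y - (\<Sum>i<n. l i * e i)) \<le> 0" using field_le_epsilon by (metis add.left_neutral less_imp_le)
  then have "y = (\<Sum>i<n. l i * e i)" using N_nonneg[of "y - (\<Sum>i<n. l i * e i)"]
    by (metis N_eq_0_iff antisym eq_iff_diff_eq_0)
  then show False using y l by blast
qed

text \<open>This is the equivalence of norms on a finite-dimensional space. The last vector has a
  positive distance \<open>\<delta>\<close> from the span of the others, which bounds the last
  coefficient; subtracting its term leaves the remaining coefficients to the induction
  hypothesis.\<close>

lemma coefficients_bounded:
  fixes e :: "nat \<Rightarrow> 'a"
  assumes "\<And>a i. (\<And>i. i < n \<Longrightarrow> a i \<in> K) \<Longrightarrow> (\<Sum>i<n. a i * e i) = 0 \<Longrightarrow> i < n \<Longrightarrow> a i = 0"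
  shows "\<exists>C>0. \<forall>a. (\<forall>i<n. a i \<in> K) \<longrightarrow> (\<forall>i<n. N (a i) \<le> C * N (\<Sum>i<n. a i * e i))"
  using assms
proof (induction n)
  case 0
  show ?case by (rule exI[of _ 1]) simp
next
  case (Suc n)
  have "\<exists>C>0. \<forall>a. (\<forall>i<n. a i \<in> K) \<longrightarrow> (\<forall>i<n. N (a i) \<le> C * N (\<Sum>i<n. a i * e i))"
  proof (rule Suc.IH)
    fix a i assume a: "\<And>i. i < n \<Longrightarrow> a i \<in> K" "(\<Sum>i<n. a i * e i) = 0" "i < n"
    have "(a(n := 0)) i = 0"
      by (rule Suc.prems) (use a subfield_0[OF subfield] in auto)
    then show "a i = 0" using a by simp
  qed
  then obtain C where C: "C > 0"
    "\<And>a i. (\<And>i. i < n \<Longrightarrow> a i \<in> K) \<Longrightarrow> i < n \<Longrightarrow> N (a i) \<le> C * N (\<Sum>i<n. a i * e i)" by blast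
  have "e n \<noteq> (\<Sum>i<n. a i * e i)" if a: "\<And>i. i < n \<Longrightarrow> a i \<in> K" for a
  proof
    assume *: "e n = (\<Sum>i<n. a i * e i)"
    have "(a(n := - 1)) n = 0" 
      by (rule Suc.prems) (use a * in \<open>auto simp: less_Suc_eq subfield_closed[OF subfield]\<close>)
    then show False by simp
  qed
  from distance_to_span_pos[where e = e and y = "e n" and n = n, OF C this]
  obtain \<delta> where \<delta>: "\<delta> > 0"
    "\<And>a. (\<forall>i<n. a i \<in> K) \<Longrightarrow> \<delta> \<le> N (e n - (\<Sum>i<n. a i * e i))" by blast
  \<comment> \<open>The first entry serves the last coefficient. The second serves the others,
    because \<open>x - a n * e n\<close> has absolute value at most
    \<open>N x * (1 + N (e n) / \<delta>)\<close>.\<close>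
  define C' where "C' = max (1 / \<delta>) (C * (1 + N (e n) / \<delta>))"
  have "N (a i) \<le> C' * N (\<Sum>i<Suc n. a i * e i)" if a: "\<forall>i<Suc n. a i \<in> K" and i: "i < Suc n" for a i
  proof -
    define x where "x = (\<Sum>i<Suc n. a i * e i)"
    have an: "N (a n) \<le> N x / \<delta>"
    proof (cases "a n = 0")
      case True
      then show ?thesis using \<delta>(1) by simp
    next
      case False
      have "\<delta> \<le> N (e n - (\<Sum>i<n. (- a i / a n) * e i))"
        using a subfield by (intro \<delta>(2)) (auto intro!: subfield_closed)
      also have "e n - (\<Sum>i<n. (- a i / a n) * e i) = x / a n"
        using False by (simp add: x_def add_divide_distrib sum_divide_distrib sum_negf)
      finally show ?thesis using \<delta>(1) False by (simp add: N_divide field_simps)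
    qed
    show ?thesis
    proof (cases "i = n")
      case True
      have "N (a n) \<le> 1 / \<delta> * N x" using an by simp
      also have "\<dots> \<le> C' * N x" by (intro mult_right_mono) (auto simp: C'_def)
      finally show ?thesis using True x_def by simp
    next
      case False
      then have "N (a i) \<le> C * N (\<Sum>i<n. a i * e i)" using a i by (intro C(2)) auto
      also have "(\<Sum>i<n. a i * e i) = x - a n * e n" by (simp add: x_def)
      also have "N (x - a n * e n) \<le> N x * (1 + N (e n) / \<delta>)"
      proof (rule N_diff_le)
        show "N x \<le> N x * (1 + N (e n) / \<delta>)"
          using \<delta>(1) by (simp add: algebra_simps)
        have "N (a n * e n) \<le> N x / \<delta> * N (e n)" unfolding N_mult using an by (intro mult_right_mono) auto
        also have "\<dots> \<le> N x * (1 + N (e n) / \<delta>)" by (simp add: algebra_simps)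
        finally show "N (a n * e n) \<le> N x * (1 + N (e n) / \<delta>)" .
      qed
      then have "C * N (x - a n * e n) \<le> C * (1 + N (e n) / \<delta>) * N x"
        using C(1) by (simp add: mult_ac)
      also have "\<dots> \<le> C' * N x" by (intro mult_right_mono) (auto simp: C'_def)
      finally show ?thesis using x_def by simp
    qed
  qed
  moreover have "C' > 0" using \<delta>(1) by (auto simp: C'_def less_max_iff_disj)
  ultimately show ?case by blast
qed

text \<open>The powers \<open>x ^ k\<close> and \<open>x' ^ k\<close> have the same coordinates in the bases of powers of \<open>x\<close> and
  \<open>x'\<close>, so \<open>(N x' / N x) ^ k\<close> is bounded in \<open>k\<close>.\<close>

lemma N_conjugate_le:
  assumes m: "is_min_poly K x m" "poly m x' = 0"
  shows "N x' \<le> N x"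
proof -
  define n where "n = degree m"
  note mp = is_min_polyD[OF m(1)]
  have poly_t: "poly t y = (\<Sum>i<n. coeff t i * y ^ i)" if "\<And>i. i \<ge> n \<Longrightarrow> coeff t i = 0" for t and y :: 'a
  proof -
    have "degree t < n" using poly_eq_0_if_coeff_0[of n t] that mp(4) n_def by fastforce
    then show ?thesis unfolding poly_altdef
      by (intro sum.mono_neutral_left) (auto simp: coeff_eq_0)
  qed
  have "\<exists>C>0. \<forall>a. (\<forall>i<n. a i \<in> K) \<longrightarrow> (\<forall>i<n. N (a i) \<le> C * N (\<Sum>i<n. a i * x ^ i))"
  proof (rule coefficients_bounded)
    fix a i assume a: "\<And>i. i < n \<Longrightarrow> a i \<in> K" "(\<Sum>i<n. a i * x ^ i) = 0" "i < n"
    define q where "q = (\<Sum>i<n. monom (a i) i)"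
    have cq: "coeff q i = (if i < n then a i else 0)" for i
      by (simp add: q_def coeff_sum sum.delta')
    have "q = 0" by (rule mp(5))
      (use a subfield_0[OF subfield] in \<open>auto simp: polys_over_def cq n_def[symmetric] poly_t\<close>)
    then show "a i = 0" using cq[of i] a(3) by simp
  qed
  then obtain C where C: "C > 0"
    "\<And>a i. (\<forall>i<n. a i \<in> K) \<Longrightarrow> i < n \<Longrightarrow> N (a i) \<le> C * N (\<Sum>i<n. a i * x ^ i)" by blast
  define D where "D = (\<Sum>i<n. N x' ^ i)"
  have D: "D \<ge> 0" unfolding D_def by (auto intro: sum_nonneg)
  have bound: "N x' ^ k \<le> C * D * N x ^ k" for k
  proof -
    obtain s t where st: "s \<in> polys_over K" "t \<in> polys_over K" "monom 1 k = s * m + t"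
      "\<And>i. i \<ge> degree m \<Longrightarrow> coeff t i = 0"
      using polys_over_division[OF subfield mp(1,2), of "monom 1 k"]
        polys_over_monom[OF subfield subfield_1[OF subfield]] by metis
    have tx: "poly t x = x ^ k"
      using arg_cong[OF st(3), of "\<lambda>q. poly q x"] mp(3) by (simp add: poly_monom)
    have tx': "poly t x' = x' ^ k"
      using arg_cong[OF st(3), of "\<lambda>q. poly q x'"] m(2) by (simp add: poly_monom)
    have pt: "poly t y = (\<Sum>i<n. coeff t i * y ^ i)" for y
      using st(4) by (intro poly_t) (auto simp: n_def)
    have c: "N (coeff t i) \<le> C * N x ^ k" if "i < n" for i
      using C(2)[of "coeff t" i] that st(2) unfolding N_power[symmetric] tx[symmetric] pt
      by (auto simp: polys_over_def)
    have "N (coeff t i * x' ^ i) \<le> C * D * N x ^ k" if "i < n" for i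
    proof -
      have "N x' ^ i \<le> D" unfolding D_def using that by (intro member_le_sum) auto
      then have "N (coeff t i * x' ^ i) \<le> (C * N x ^ k) * D"
        using c[OF that] C(1) by (simp add: N_mult N_power mult_mono)
      then show ?thesis by (simp add: mult_ac)
    qed
    then have "N (\<Sum>i<n. coeff t i * x' ^ i) \<le> C * D * N x ^ k"
      using C(1) D by (intro N_sum_le) auto
    then show ?thesis unfolding N_power[symmetric] tx'[symmetric] pt .
  qed
  show ?thesis
  proof (rule ccontr)
    assume "\<not> ?thesis"
    then have less: "N x < N x'" by simp
    have "N x \<noteq> 0" using bound[of 1] less by (metis mult_zero_right not_le power_one_right)
    then have pos: "N x > 0" using N_nonneg[of x] by linarith
    then have "N x' / N x > 1" using less by simp
    then obtain k where "C * D < (N x' / N x) ^ k" using real_arch_pow by blast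
    then have "C * D * N x ^ k < N x' ^ k" using pos by (simp add: power_divide field_simps)
    then show False using bound[of k] by simp
  qed
qed

end

section \<open>Automorphisms over a subfield\<close>

lemma galois_groupD:
  assumes "\<sigma> \<in> galois_group L"
  shows "\<sigma> (x + y) = \<sigma> x + \<sigma> y" "\<sigma> (x * y) = \<sigma> x * \<sigma> y" "a \<in> L \<Longrightarrow> \<sigma> a = a" "inj \<sigma>"
  using assms by (auto simp: galois_group_def bij_def)

lemma galois_group_0: "\<sigma> \<in> galois_group L \<Longrightarrow> \<sigma> 0 = 0"
  using galois_groupD(1)[of \<sigma> L 0 0] by (metis add.right_neutral add_left_cancel)

lemma galois_group_minus: "\<sigma> \<in> galois_group L \<Longrightarrow> \<sigma> (- x) = - \<sigma> x"
  using galois_groupD(1)[of \<sigma> L x "- x"] galois_group_0[of \<sigma> L] by (simp add: eq_neg_iff_add_eq_0 add.commute)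

lemma galois_group_diff: "\<sigma> \<in> galois_group L \<Longrightarrow> \<sigma> (x - y) = \<sigma> x - \<sigma> y"
  using galois_groupD(1)[of \<sigma> L x "- y"] galois_group_minus by simp

lemma galois_group_1:
  assumes "\<sigma> \<in> galois_group L"
  shows "\<sigma> 1 = 1"
proof -
  have "\<sigma> 1 \<noteq> 0" using galois_groupD(4)[OF assms] galois_group_0[OF assms] by (metis injD zero_neq_one)
  then show ?thesis using galois_groupD(2)[OF assms, of 1 1] by simp
qed

lemma galois_group_power: "\<sigma> \<in> galois_group L \<Longrightarrow> \<sigma> (x ^ n) = \<sigma> x ^ n"
  by (induction n) (auto simp: galois_groupD galois_group_1)

lemma galois_group_antimono: "K \<subseteq> L \<Longrightarrow> galois_group L \<subseteq> galois_group K"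
  by (auto simp: galois_group_def)

lemma galois_group_poly:
  assumes "\<sigma> \<in> galois_group L" "q \<in> polys_over L"
  shows "\<sigma> (poly q x) = poly q (\<sigma> x)"
  using assms(2)
proof (induction q)
  case 0
  then show ?case by (simp add: galois_group_0[OF assms(1)])
next
  case (pCons a q)
  have "a \<in> L" "q \<in> polys_over L" using pCons.prems unfolding polys_over_def
    by (auto simp: coeff_pCons split: nat.splits)
  then show ?case using pCons.IH galois_groupD[OF assms(1)] by simp
qed

section \<open>Reductions of polynomials\<close>

context nonarch_abs
begin

lemma max_coeff:
  assumes "t \<noteq> 0"
  obtains B where "B > 0" "\<And>j. N (coeff t j) \<le> B" "finite {i. N (coeff t i) = B}"
    "{i. N (coeff t i) = B} \<noteq> {}"
proof -
  define B where "B = Max ((\<lambda>i. N (coeff t i)) ` {..degree t})"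
  have le: "N (coeff t j) \<le> B" if "j \<le> degree t" for j
    unfolding B_def using that by (intro Max_ge) auto
  have pos: "B > 0" using le[of "degree t"] assms N_pos[of "lead_coeff t"]
    by (simp del: N_pos) 
  have "N (coeff t j) \<le> B" for j
    using le[of j] pos by (cases "j \<le> degree t") (auto simp: coeff_eq_0)
  moreover have "{i. N (coeff t i) = B} \<subseteq> {..degree t}" using pos le_degree[of t] by force
  then have "finite {i. N (coeff t i) = B}" by (rule finite_subset) simp
  moreover have "B \<in> (\<lambda>i. N (coeff t i)) ` {..degree t}" unfolding B_def by (intro Max_in) auto
  ultimately show ?thesis using pos that by blast
qed

text \<open>After division by this coefficient, the reduction of \<open>t\<close> has degree exactly
  \<open>i\<close>.\<close>

lemma last_max_coeff:
  assumes "t \<noteq> 0"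
  obtains i where "coeff t i \<noteq> 0" "\<And>j. N (coeff t j) \<le> N (coeff t i)"
    "\<And>j. j > i \<Longrightarrow> N (coeff t j) < N (coeff t i)"
proof -
  obtain B where B: "B > 0" "\<And>j. N (coeff t j) \<le> B" "finite {i. N (coeff t i) = B}"
    "{i. N (coeff t i) = B} \<noteq> {}" using max_coeff[OF assms] by metis
  define i where "i = Max {i. N (coeff t i) = B}"
  have i: "N (coeff t i) = B" using Max_in[OF B(3,4)] i_def by simp
  have "N (coeff t j) \<noteq> B" if "j > i" for j
    using that Max_ge[OF B(3), of j] i_def by auto
  then have "N (coeff t j) < B" if "j > i" for j
    using B(2)[of j] that by (simp add: order.strict_iff_order)
  then show ?thesis using that[of i] B(1,2) i by force
qed

text \<open>After division by this coefficient, the reduction of \<open>t\<close> vanishes at 0 to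
  order exactly \<open>i\<close>.\<close>

lemma first_max_coeff:
  assumes "t \<noteq> 0"
  obtains i where "coeff t i \<noteq> 0" "\<And>j. N (coeff t j) \<le> N (coeff t i)"
    "\<And>j. j < i \<Longrightarrow> N (coeff t j) < N (coeff t i)"
proof -
  obtain B where B: "B > 0" "\<And>j. N (coeff t j) \<le> B" "finite {i. N (coeff t i) = B}"
    "{i. N (coeff t i) = B} \<noteq> {}" using max_coeff[OF assms] by metis
  define i where "i = Min {i. N (coeff t i) = B}"
  have i: "N (coeff t i) = B" using Min_in[OF B(3,4)] i_def by simp
  have "N (coeff t j) \<noteq> B" if "j < i" for j
    using that Min_le[OF B(3), of j] i_def by auto
  then have "N (coeff t j) < B" if "j < i" for j
    using B(2)[of j] that by (simp add: order.strict_iff_order)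
  then show ?thesis using that[of i] B(1,2) i by force
qed

lemma N_power_le_1: "N x \<le> 1 \<Longrightarrow> N (x ^ n) \<le> 1"
  by (simp add: N_power power_le_one)

lemma N_mult_less_1: "N x \<le> 1 \<Longrightarrow> N y < 1 \<Longrightarrow> N (x * y) < 1"
  by (metis N_mult N_nonneg le_less_trans mult_left_le_one_le)

lemma N_mult_le_1: "N x \<le> 1 \<Longrightarrow> N y \<le> 1 \<Longrightarrow> N (x * y) \<le> 1"
  by (simp add: N_mult mult_le_one)

lemma N_power_cong:
  assumes "N x \<le> 1" "N y \<le> 1" "N (x - y) < 1"
  shows "N (x ^ n - y ^ n) < 1"
proof (induction n)
  case (Suc n)
  have "N (x * (x ^ n - y ^ n)) < 1" using Suc assms(1) by (intro N_mult_less_1)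
  moreover have "N (y ^ n * (x - y)) < 1" using assms by (intro N_mult_less_1 N_power_le_1)
  then have "N ((x - y) * y ^ n) < 1" by (simp add: mult.commute)
  ultimately have "N (x * (x ^ n - y ^ n) + (x - y) * y ^ n) < 1" by (rule N_add_less)
  then show ?case by (simp add: algebra_simps)
qed simp

lemma N_poly_le_1:
  assumes "\<And>i. N (coeff q i) \<le> 1" "N x \<le> 1"
  shows "N (poly q x) \<le> 1"
  unfolding poly_altdef using assms by (intro N_sum_le N_mult_le_1 N_power_le_1) auto

lemma N_poly_less_1:
  assumes "\<And>i. N (coeff q i) < 1" "N x \<le> 1"
  shows "N (poly q x) < 1"
  unfolding poly_altdef
proof (rule N_sum_less)
  fix i show "N (coeff q i * x ^ i) < 1"
    using N_mult_less_1[OF N_power_le_1[OF assms(2)] assms(1)] by (simp add: mult.commute)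
qed simp

lemma N_poly_cong:
  assumes "\<And>i. N (coeff q i) \<le> 1" "N x \<le> 1" "N y \<le> 1" "N (x - y) < 1"
  shows "N (poly q x - poly q y) < 1"
proof -
  have "poly q x - poly q y = (\<Sum>i\<le>degree q. coeff q i * (x ^ i - y ^ i))"
    by (simp add: poly_altdef right_diff_distrib sum_subtractf)
  also have "N \<dots> < 1" using assms by (intro N_sum_less N_mult_less_1 N_power_cong) auto
  finally show ?thesis .
qed

lemma N_coeff_prod_linear_le_1:
  assumes "\<And>x. x \<in> set xs \<Longrightarrow> N x \<le> 1"
  shows "N (coeff (\<Prod>x\<leftarrow>xs. [:- x, 1:]) i) \<le> 1"
  using assms
proof (induction xs arbitrary: i)
  case Nil
  then show ?case by (simp add: coeff_1)
next
  case (Cons x xs)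
  have "N (coeff (\<Prod>x\<leftarrow>xs. [:- x, 1:]) i) \<le> 1" for i using Cons by simp
  then have "N (- x * coeff (\<Prod>x\<leftarrow>xs. [:- x, 1:]) i +
      (case i of 0 \<Rightarrow> 0 | Suc k \<Rightarrow> coeff (\<Prod>x\<leftarrow>xs. [:- x, 1:]) k)) \<le> 1"
    using Cons.prems[of x] by (intro N_add_le N_mult_le_1) (auto split: nat.splits)
  then show ?case by (simp add: coeff_pCons split: nat.splits)
qed

text \<open>Replacing every root by \<open>u\<close> turns the product into the power
  \<open>(X - u) ^ length xs\<close>, and each coefficient changes by less than its natural size in
  terms of \<open>N u\<close>.\<close>

lemma coeff_prod_linear_close:
  assumes u: "u \<noteq> 0" and "\<And>x. x \<in> set xs \<Longrightarrow> N (x - u) < N u" "i \<le> length xs"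
  shows "N (coeff (\<Prod>x\<leftarrow>xs. [:- x, 1:]) i - of_nat (length xs choose i) * (- u) ^ (length xs - i))
    < N u ^ (length xs - i)"
  using assms(2,3)
proof (induction xs arbitrary: i)
  case Nil
  then show ?case by simp
next
  case (Cons x xs)
  define n where "n = length xs"
  define P where "P = (\<Prod>x\<leftarrow>xs. [:- x, 1:])"
  define E where "E j = of_nat (n choose j) * (- u) ^ (n - j)" for j
  have IH: "N (coeff P j - E j) < N u ^ (n - j)" if "j \<le> n" for j
    using Cons.IH[of j] Cons.prems(1) that unfolding P_def E_def n_def by simp
  have Nu: "N u > 0" using u by simp
  have xu: "N (x - u) < N u" using Cons.prems(1) by simp
  have Nx: "N x = N u" using N_eq_if_close[of u x] xu by (simp add: N_diff_commute)
  have E: "N (E j) \<le> N u ^ (n - j)" for j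
  proof -
    have "N (of_nat (n choose j)) * N u ^ (n - j) \<le> 1 * N u ^ (n - j)"
      using N_of_nat_le by (intro mult_right_mono) auto
    then show ?thesis by (simp add: E_def N_mult N_power)
  qed
  \<comment> \<open>The difference splits into an error of the coefficient, multiplied by
    \<open>x\<close>, and the error \<open>x - u\<close>, multiplied by \<open>E j\<close>; both are
    small.\<close>
  have g: "N (- x * coeff P j - (- u) * E j) < N u ^ (Suc n - j)" if "j \<le> n" for j
  proof -
    have "N (- x * (coeff P j - E j)) < N u * N u ^ (n - j)"
      using IH[OF that] Nu by (simp only: N_mult N_minus Nx mult_less_cancel_left_pos)
    moreover have "N ((x - u) * E j) < N u * N u ^ (n - j)"
    proof -
      have "N (x - u) * N (E j) \<le> N (x - u) * N u ^ (n - j)" using E by (intro mult_left_mono) auto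
      also have "\<dots> < N u * N u ^ (n - j)" using xu Nu by simp
      finally show ?thesis by (simp add: N_mult)
    qed
    ultimately have "N (- x * (coeff P j - E j) - (x - u) * E j) < N u * N u ^ (n - j)"
      by (rule N_diff_less)
    then show ?thesis using that by (simp add: algebra_simps Suc_diff_le)
  qed
  have cP: "coeff (\<Prod>x\<leftarrow>x # xs. [:- x, 1:]) i = - x * coeff P i + (case i of 0 \<Rightarrow> 0 | Suc k \<Rightarrow> coeff P k)"
    by (simp add: P_def coeff_pCons split: nat.splits)
  show ?case
  proof (cases i)
    case 0
    then show ?thesis using g[of 0] unfolding cP by (simp add: E_def n_def)
  next
    case (Suc k)
    then have k: "k \<le> n" using Cons.prems(2) n_def by simp
    have IHk: "N (coeff P k - E k) < N u ^ (Suc n - i)" using IH[OF k] Suc by simp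
    show ?thesis
    \<comment> \<open>For \<open>k = n\<close> the index \<open>i\<close> exceeds the degree of
      \<open>P\<close>, where \<open>coeff P i\<close> vanishes and \<open>E i\<close> is not the
      right comparison term.\<close>
    proof (cases "k = n")
      case True
      then show ?thesis unfolding cP using IHk Suc
        by (simp add: n_def[symmetric] E_def) (simp add: P_def n_def coeff_prod_linear_eq_0)
    next
      case False
      then have i: "i \<le> n" using k Suc by simp
      have "N ((- x * coeff P i - (- u) * E i) + (coeff P k - E k)) < N u ^ (Suc n - i)"
        by (rule N_add_less[OF g[OF i] IHk])
      \<comment> \<open>Pascal's rule combines \<open>- u * E i\<close> and \<open>E k\<close> into
        the binomial term for \<open>Suc n\<close>.\<close>
      also have "(- x * coeff P i - (- u) * E i) + (coeff P k - E k) =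
        (- x * coeff P i + coeff P k) - of_nat (Suc n choose i) * (- u) ^ (Suc n - i)"
      proof -
        have "n - k = Suc (n - i)" using i Suc by simp
        then have "(- u) ^ (n - k) = (- u) * (- u) ^ (n - i)" by simp
        moreover have "Suc n - i = n - k" using Suc by simp
        ultimately show ?thesis using Suc by (simp add: E_def algebra_simps)
      qed
      finally show ?thesis unfolding cP using Suc by (simp add: n_def)
    qed
  qed
qed

end

subsection \<open>Tame elements over a local field\<close>

locale local_closure = complete_subfield N K for N :: "'a::field \<Rightarrow> real" and K +
  fixes p :: nat
  assumes alg_closed: "alg_closed_field TYPE('a)" and algebraic: "algebraic_over K"
    and prime_p: "prime p" and N_p: "N (of_nat p) < 1"
    and discrete: "\<And>x y. x \<in> K \<Longrightarrow> y \<in> K \<Longrightarrow> N x < N y \<Longrightarrow> N x \<le> N y / 2"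
    and residue_finite: "\<exists>S. finite S \<and> (\<forall>a\<in>K. N a \<le> 1 \<longrightarrow> (\<exists>s\<in>S. N (a - s) < 1))"
begin

text \<open>The image of an element is a root of its minimal polynomial, so \<open>\<sigma>\<close>
  does not increase \<open>N\<close>; applied to the inverse of \<open>x\<close> this gives the
  other inequality.\<close>

lemma galois_N:
  assumes \<sigma>: "\<sigma> \<in> galois_group K"
  shows "N (\<sigma> x) = N x"
proof (cases "x = 0")
  case True
  then show ?thesis by (simp add: galois_group_0[OF \<sigma>])
next
  case False
  have le: "N (\<sigma> y) \<le> N y" for y
  proof -
    obtain m where m: "is_min_poly K y m" using min_poly_exists[OF subfield algebraic order_refl] .
    then have "poly m (\<sigma> y) = 0"
      using galois_group_poly[OF \<sigma> is_min_polyD(1)[OF m], of y] is_min_polyD(3)[OF m]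
        galois_group_0[OF \<sigma>] by simp
    with m show ?thesis by (rule N_conjugate_le)
  qed
  have "\<sigma> x * \<sigma> (inverse x) = 1"
    using galois_groupD(2)[OF \<sigma>, of x "inverse x"] False galois_group_1[OF \<sigma>] by simp
  then have 1: "N (\<sigma> x) * N (\<sigma> (inverse x)) = 1" by (simp flip: N_mult)
  then have "N (\<sigma> x) * N (\<sigma> (inverse x)) \<le> N (\<sigma> x) * inverse (N x)"
    using le[of "inverse x"] by (intro mult_left_mono) (auto simp: N_inverse)
  then have "N x \<le> N (\<sigma> x)" using 1 False N_pos[of x] by (simp add: field_simps del: N_pos)
  with le[of x] show ?thesis by simp
qed

lemma min_poly_conjugates:
  assumes "is_min_poly K x m"
  obtains xs where "length xs = degree m" "m = (\<Prod>x\<leftarrow>xs. [:- x, 1:])"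
    "\<And>y. y \<in> set xs \<Longrightarrow> \<exists>\<sigma>\<in>galois_group K. \<sigma> x = y"
proof -
  obtain xs where xs: "length xs = degree m" "m = (\<Prod>x\<leftarrow>xs. [:- x, 1:])"
    using alg_closed_splits[OF alg_closed, of m] is_min_polyD(2)[OF assms] by auto
  moreover have "\<exists>\<sigma>\<in>galois_group K. \<sigma> x = y" if "y \<in> set xs" for y
  proof -
    have "poly m y = 0" using that unfolding xs(2) poly_prod_list_linear_0_iff .
    then show ?thesis
      using conjugate_by_automorphism[OF alg_closed subfield algebraic subfield order_refl assms] by metis
  qed
  ultimately show ?thesis using that by blast
qed

section \<open>The Frobenius map on residues\<close>

lemma frobenius_add:
  assumes "N x \<le> 1" "N y \<le> 1"
  shows "N ((x + y) ^ p - (x ^ p + y ^ p)) < 1"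
proof -
  let ?h = "\<lambda>k. of_nat (p choose k) * x ^ k * y ^ (p - k)"
  have p1: "p > 1" using prime_p prime_gt_1_nat by blast
  then have "{..p} = insert 0 (insert p {1..<p})" by auto
  then have "(x + y) ^ p - (x ^ p + y ^ p) = (\<Sum>k\<in>{1..<p}. ?h k)"
    unfolding binomial_ring using p1 by simp
  also have "N \<dots> < 1"
  proof (rule N_sum_less)
    fix k assume k: "k \<in> {1..<p}"
    then have "p dvd (p choose k)" using prime_p by (intro dvd_choose_prime) auto
    then obtain c where c: "p choose k = c * p" by (metis dvd_def mult.commute)
    have "N (of_nat c * of_nat p) < 1" using N_of_nat_le N_p by (rule N_mult_less_1)
    then have "N ((x ^ k * y ^ (p - k)) * of_nat (p choose k)) < 1"
      unfolding c using assms by (intro N_mult_less_1 N_mult_le_1 N_power_le_1) auto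
    then show "N (?h k) < 1" by (simp add: mult_ac)
  qed simp
  finally show ?thesis .
qed

text \<open>Injectivity of Frobenius on residues. Additivity is applied to
  \<open>a = (a - b) + b\<close>, which avoids the sign of \<open>(- b) ^ p\<close>.\<close>

lemma frobenius_cancel:
  assumes "N x \<le> 1" "N y \<le> 1" "N (x ^ p ^ k - y ^ p ^ k) < 1"
  shows "N (x - y) < 1"
  using assms
proof (induction k arbitrary: x y)
  case (Suc k)
  have one: "N (a - b) < 1" if "N a \<le> 1" "N b \<le> 1" "N (a ^ p - b ^ p) < 1" for a b
  proof -
    have "N (((a - b) + b) ^ p - ((a - b) ^ p + b ^ p)) < 1"
      using that by (intro frobenius_add N_diff_le) auto
    then have "N (a ^ p - ((a - b) ^ p + b ^ p)) < 1" by simp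
    from N_diff_less[OF that(3) this] have "N (a - b) ^ p < 1" by (simp add: N_power)
    then show ?thesis using one_le_power[of "N (a - b)" p] by linarith
  qed
  have "x ^ p ^ Suc k = (x ^ p) ^ p ^ k" "y ^ p ^ Suc k = (y ^ p) ^ p ^ k" by (simp_all add: power_mult)
  then have "N (x ^ p - y ^ p) < 1"
    using Suc.prems Suc.IH[of "x ^ p" "y ^ p"] N_power_le_1 by simp
  with Suc.prems show ?case using one by blast
qed simp

text \<open>The finite residue field is perfect: the iterated \<open>p\<close>-th powers of
  \<open>b\<close> repeat modulo the maximal ideal, and by injectivity the residue of
  \<open>b\<close> itself is periodic with some period \<open>d\<close>. Since
  \<open>d * j \<ge> j\<close>, going round \<open>j\<close> periods and stopping \<open>j\<close>
  steps early gives the root.\<close>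

lemma frobenius_root:
  assumes b: "b \<in> K" "N b \<le> 1"
  obtains c where "c \<in> K" "N c \<le> 1" "N (c ^ p ^ j - b) < 1"
proof -
  obtain S where S: "finite S" "\<And>a. a \<in> K \<Longrightarrow> N a \<le> 1 \<Longrightarrow> \<exists>s\<in>S. N (a - s) < 1"
    using residue_finite by blast
  have "\<exists>s\<in>S. N (b ^ p ^ k - s) < 1" for k
    using b by (intro S(2) subfield_power[OF subfield] N_power_le_1)
  then obtain s where s: "\<And>k. s k \<in> S" "\<And>k. N (b ^ p ^ k - s k) < 1" by metis
  have "\<not> inj s" using S(1) s(1) by (metis finite_imageD finite_subset image_subsetI infinite_UNIV_nat)
  then obtain i k where "s i = s k" "i < k" by (metis linorder_injI)
  then obtain d where d: "d > 0" "s i = s (i + d)" by (metis less_imp_add_positive)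
  have "N (b ^ p ^ (i + d) - b ^ p ^ i) < 1"
    using s(2)[of "i + d"] s(2)[of i] d(2) N_triangle_less[of "b ^ p ^ (i + d)" "s i" 1 "b ^ p ^ i"]
      N_diff_commute[of "s i" "b ^ p ^ i"] by simp
  moreover have "b ^ p ^ (i + d) = (b ^ p ^ d) ^ p ^ i" by (simp add: power_iterate add.commute)
  ultimately have bd: "N (b ^ p ^ d - b) < 1"
    using frobenius_cancel[of "b ^ p ^ d" b i] b(2) N_power_le_1[OF b(2), of "p ^ d"] by simp
  have "N (b ^ p ^ (d * j) - b) < 1"
  proof (induction j)
    case (Suc j)
    have "N ((b ^ p ^ d) ^ p ^ (d * j) - b ^ p ^ (d * j)) < 1"
      by (rule N_power_cong[OF N_power_le_1[OF b(2)] b(2) bd])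
    moreover have "(b ^ p ^ d) ^ p ^ (d * j) = b ^ p ^ (d * Suc j)"
      by (simp add: power_iterate)
    ultimately show ?case using Suc N_triangle_less[of "b ^ p ^ (d * Suc j)"] by simp
  qed simp
  moreover have "(b ^ p ^ (d * j - j)) ^ p ^ j = b ^ p ^ (d * j)"
    using d(1) by (simp add: power_iterate)
  ultimately show ?thesis
    using that[of "b ^ p ^ (d * j - j)"] subfield_power[OF subfield b(1)] N_power_le_1[OF b(2)] by simp
qed

lemma N_of_nat_coprime:
  assumes "\<not> p dvd B"
  shows "N (of_nat B) = 1"
proof (rule ccontr)
  assume "N (of_nat B) \<noteq> 1"
  then have B: "N (of_nat B) < 1" using N_of_nat_le[of B] by simp
  have "coprime (int p) (int B)" using assms prime_p by (simp add: prime_imp_coprime)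
  then obtain x y where "x * int p + y * int B = 1"
    using bezout_int[of "int p" "int B"] by auto
  then have "(of_int (x * int p + y * int B) :: 'a) = 1" by simp
  then have "of_int x * of_nat p + of_int y * of_nat B = (1 :: 'a)" by simp
  moreover have "N (of_int x * of_nat p + of_int y * of_nat B) < 1"
    using B N_p by (intro N_add_less N_mult_less_1 N_of_int_le)
  ultimately show False by simp
qed

end

section \<open>Value groups and residue fields of intermediate fields\<close>

context local_closure
begin

text \<open>Up to sign, the constant coefficient of the minimal polynomial is the product of the
  conjugates of \<open>x\<close>, all of which have absolute value \<open>N x\<close>.\<close>

lemma N_power_in_value_group:
  assumes "x \<noteq> 0"
  obtains n where "n > 0" "N x ^ n \<in> N ` K"
proof -
  obtain m where m: "is_min_poly K x m" using min_poly_exists[OF subfield algebraic order_refl] .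
  obtain xs where xs: "length xs = degree m" "m = (\<Prod>x\<leftarrow>xs. [:- x, 1:])"
    "\<And>y. y \<in> set xs \<Longrightarrow> \<exists>\<sigma>\<in>galois_group K. \<sigma> x = y" using min_poly_conjugates[OF m] by blast
  have "N y = N x" if "y \<in> set xs" for y using xs(3)[OF that] galois_N by blast
  then have "N (poly (\<Prod>x\<leftarrow>xs. [:- x, 1:]) 0) = N x ^ length xs"
    by (induction xs) (auto simp: N_mult)
  then have "N (coeff m 0) = N x ^ degree m" using xs(1,2) by (simp add: poly_0_coeff_0)
  then show ?thesis using that[of "degree m"] is_min_polyD(1,4)[OF m]
    by (metis (mono_tags, lifting) image_eqI mem_Collect_eq polys_over_def)
qed

lemma N_image_divide:
  assumes "is_subfield L" "a \<in> N ` L" "b \<in> N ` L"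
  shows "a / b \<in> N ` L"
  using assms subfield_divide by (force simp: N_divide image_iff)

lemma N_image_power:
  assumes "is_subfield L" "a \<in> N ` L"
  shows "a ^ n \<in> N ` L"
  using assms subfield_power by (force simp: N_power image_iff)

text \<open>\<open>L\<close> stands in for the maximal tamely ramified extension: maximality makes its residue
  field algebraically closed and its value group divisible by integers prime to \<open>p\<close>, which forces
  every automorphism over \<open>L\<close> to be wild.\<close>

context
  fixes L u j
  assumes L: "is_subfield L" "K \<subseteq> L" and u: "u \<noteq> 0" "N u \<notin> N ` L" "N u ^ p ^ j \<in> N ` K"
    and max: "\<And>M. is_subfield M \<Longrightarrow> L \<subseteq> M \<Longrightarrow> N u \<notin> N ` M \<Longrightarrow> M = L"
begin

lemma adjoin_in_maximal:
  assumes "N u \<notin> N ` adjoin L y"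
  shows "y \<in> L"
  using max[OF subfield_adjoin[OF L(1) subfield algebraic L(2)] subset_adjoin[OF L(1) subfield algebraic L(2)]
      assms] in_adjoin[OF L(1) subfield algebraic L(2), of y] by simp

text \<open>The extension obtained by an \<open>e\<close>-th root with \<open>e\<close> prime to \<open>p\<close> cannot reach the value \<open>N u\<close>.\<close>

lemma maximal_field_values:
  assumes "x \<noteq> 0"
  obtains k a where "a \<in> L" "N a = N x ^ p ^ k"
proof -
  obtain n where n: "n > 0" "N x ^ n \<in> N ` K" using N_power_in_value_group[OF assms] .
  obtain n' where n': "n = p ^ multiplicity p n * n'" "\<not> p dvd n'"
    using n(1) multiplicity_decompose'[of n p] prime_p by (metis not_prime_unit not_gr0)
  define k where "k = multiplicity p n"
  define x' where "x' = x ^ p ^ k"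
  have x'0: "x' \<noteq> 0" using assms by (simp add: x'_def)
  have n'V: "N x' ^ n' \<in> N ` L"
    using n(2) n'(1) L(2) unfolding x'_def k_def by (auto simp: N_power simp flip: power_mult)
  have n'0: "n' > 0" using n'(1) n(1) by (cases n') auto
  \<comment> \<open>\<open>e\<close> is the order of \<open>N x'\<close> modulo the value group of
    \<open>L\<close>; it divides \<open>n'\<close> and is therefore prime to
    \<open>p\<close>.\<close>
  define e where "e = (LEAST e. e > 0 \<and> N x' ^ e \<in> N ` L)"
  have e: "e > 0" "N x' ^ e \<in> N ` L"
    using LeastI[of "\<lambda>e. e > 0 \<and> N x' ^ e \<in> N ` L" n'] n'V n'0 unfolding e_def by auto
  have least: "e \<le> i" if "i > 0" "N x' ^ i \<in> N ` L" for i
    unfolding e_def using that by (intro Least_le) auto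
  have "e dvd n'"
  proof (rule ccontr)
    assume "\<not> e dvd n'"
    then have r: "n' mod e > 0" by (simp add: mod_greater_zero_iff_not_dvd)
    have "N x' ^ n' = N x' ^ (n' mod e) * (N x' ^ e) ^ (n' div e)"
      by (simp flip: power_mult power_add)
    then have "N x' ^ (n' mod e) = N x' ^ n' / (N x' ^ e) ^ (n' div e)"
      using x'0 by simp
    then have "N x' ^ (n' mod e) \<in> N ` L"
      using N_image_divide[OF L(1) n'V N_image_power[OF L(1) e(2)]] by simp
    then show False using least[OF r] e(1) by (metis mod_less_divisor not_le)
  qed
  then have "\<not> p dvd e" using n'(2) dvd_trans by blast
  then have cop: "coprime e (p ^ j)" using prime_p
    by (metis coprime_commute coprime_power_left_iff coprime_power_right_iff prime_imp_coprime)
  obtain a where a: "a \<in> L" "N a = N x' ^ e" using e(2) by auto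
  define h where "h = monom 1 e - [:a:]"
  have h: "coeff h i = (if i = e then 1 else 0) - (if i = 0 then a else 0)" for i
    by (simp add: h_def coeff_pCons split: nat.splits)
  have "degree h = e" 
    by (rule antisym[OF degree_le le_degree]) (use e(1) in \<open>auto simp: h\<close>)
  then have lch: "lead_coeff h = 1" using e(1) by (simp add: h)
  have hL: "h \<in> polys_over L"
    using a subfield_1[OF L(1)] subfield_0[OF L(1)] L(1) unfolding polys_over_def
    by (auto simp: h intro: subfield_closed)
  obtain y where "poly h y = 0" using alg_closed_root[OF alg_closed, of h] e(1) \<open>degree h = e\<close> by auto
  then have y: "y ^ e = a" by (simp add: h_def poly_monom)
  have "N y ^ e = N x' ^ e" using y a(2) by (metis N_power)
  then have Ny: "N y = N x'" using e(1) by (simp add: power_eq_iff_eq_base)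
  have "N u \<notin> N ` adjoin L y"
  proof
    assume "N u \<in> N ` adjoin L y"
    then obtain q where q: "q \<in> polys_over L" "N u = N (poly q y)" unfolding adjoin_def by auto
    obtain s t where st: "s \<in> polys_over L" "t \<in> polys_over L" "q = s * h + t"
      "\<And>i. i \<ge> degree h \<Longrightarrow> coeff t i = 0" using polys_over_division[OF L(1) hL lch q(1)] by metis
    have ut: "N u = N (poly t y)" using q(2) st(3) \<open>poly h y = 0\<close> by simp
    then have "poly t y \<noteq> 0" using u(1) by (metis N_eq_0_iff)
    then have "t \<noteq> 0" by auto
    then have dt: "degree t < e" using poly_eq_0_if_coeff_0[of e t] st(4) \<open>degree h = e\<close> by auto
    have tL: "coeff t i \<in> L" for i using st(2) by (auto simp: polys_over_def)
    \<comment> \<open>Two terms of equal value would put a power of \<open>N x'\<close> with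
      positive exponent below \<open>e\<close> into the value group of \<open>L\<close>.\<close>
    have key: "N (coeff t i * y ^ i) \<noteq> N (coeff t i' * y ^ i')"
      if "i < i'" "i' \<le> degree t" "coeff t i \<noteq> 0" for i i'
    proof
      assume eq: "N (coeff t i * y ^ i) = N (coeff t i' * y ^ i')"
      then have nz: "coeff t i' \<noteq> 0" using that(3) x'0 Ny by (auto simp: N_mult N_power)
      have "N x' ^ i' = N x' ^ (i' - i) * N x' ^ i" using that(1) by (simp flip: power_add)
      then have "N x' ^ (i' - i) = N (coeff t i) / N (coeff t i')"
        using eq nz x'0 by (simp add: N_mult N_power Ny field_simps)
      then have "N x' ^ (i' - i) \<in> N ` L" using N_image_divide[OF L(1)] tL by simp
      then show False using least[of "i' - i"] that dt by simp
    qed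
    have "\<exists>i\<in>{..degree t}. coeff t i * y ^ i \<noteq> 0 \<and> N (\<Sum>i\<le>degree t. coeff t i * y ^ i) = N (coeff t i * y ^ i)"
    proof (rule N_sum_distinct)
      fix i i' assume ii: "i \<in> {..degree t}" "i' \<in> {..degree t}" "i \<noteq> i'" "coeff t i * y ^ i \<noteq> 0"
      show "N (coeff t i * y ^ i) \<noteq> N (coeff t i' * y ^ i')"
      proof (cases "coeff t i' * y ^ i' = 0")
        case True
        then show ?thesis using ii(4) by (metis N_eq_0_iff)
      next
        case False
        then show ?thesis using key[of i i'] key[of i' i] ii by (cases i i' rule: linorder_cases) auto
      qed
    qed (use \<open>poly t y \<noteq> 0\<close> in \<open>auto simp: poly_altdef\<close>)
    then obtain i where "N u = N (coeff t i * y ^ i)" using ut unfolding poly_altdef by auto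
    then have "N u ^ e = N ((coeff t i * y ^ i) ^ e)" by (simp add: N_power)
    also have "(coeff t i * y ^ i) ^ e = coeff t i ^ e * a ^ i"
      unfolding y[symmetric] by (simp add: power_mult_distrib mult.commute flip: power_mult)
    finally have "N u ^ e = N (coeff t i ^ e * a ^ i)" .
    then have ue: "N u ^ e \<in> N ` L" using tL a(1) L(1) by (auto intro: subfield_closed)
    \<comment> \<open>Both \<open>N u ^ e\<close> and \<open>N u ^ p ^ j\<close> are values of
      \<open>L\<close>; as the exponents are coprime, so is \<open>N u\<close>.\<close>
    obtain c d where cd: "e * c = p ^ j * d + 1"
      using bezout_nat[of e "p ^ j"] e(1) cop by auto
    have "(N u ^ e) ^ c = N u * (N u ^ p ^ j) ^ d"
      using cd by (simp flip: power_mult)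
    then have "N u = (N u ^ e) ^ c / (N u ^ p ^ j) ^ d" using u(1) by simp
    moreover have "N u ^ p ^ j \<in> N ` L" using u(3) L(2) by auto
    ultimately have "N u \<in> N ` L"
      using N_image_divide[OF L(1) N_image_power[OF L(1) ue] N_image_power[OF L(1)]] by metis
    then show False using u(2) by contradiction
  qed
  then have "y \<in> L" by (rule adjoin_in_maximal)
  then show ?thesis using that[of y k] Ny by (simp add: x'_def N_power)
qed

text \<open>Adjoining a lift of a root of an irreducible residual polynomial does not change the
  value group, so the residue field of \<open>L\<close> is algebraically closed.\<close>

lemma maximal_field_residue:
  assumes x: "N x \<le> 1"
  obtains y where "y \<in> L" "N (x - y) < 1"
proof -
  \<comment> \<open>A polynomial of least degree with this property lifts the minimal polynomial of
    the residue of \<open>x\<close> over the residue field of \<open>L\<close>.\<close>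
  let ?P = "\<lambda>h. h \<in> polys_over L \<and> lead_coeff h = 1 \<and> (\<forall>i. N (coeff h i) \<le> 1) \<and> N (poly h x) < 1"
  have "\<exists>h. ?P h"
  proof -
    obtain m where m: "is_min_poly K x m" using min_poly_exists[OF subfield algebraic order_refl] .
    obtain xs where xs: "length xs = degree m" "m = (\<Prod>x\<leftarrow>xs. [:- x, 1:])"
      "\<And>y. y \<in> set xs \<Longrightarrow> \<exists>\<sigma>\<in>galois_group K. \<sigma> x = y" using min_poly_conjugates[OF m] by blast
    have "N y \<le> 1" if "y \<in> set xs" for y using xs(3)[OF that] galois_N x by auto
    then have "N (coeff m i) \<le> 1" for i unfolding xs(2) by (rule N_coeff_prod_linear_le_1)
    then have "?P m" using is_min_polyD[OF m] polys_over_mono[OF L(2)] by auto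
    then show ?thesis ..
  qed
  then obtain h0 where "?P h0" ..
  then obtain h where h: "?P h" and least: "\<And>s. ?P s \<Longrightarrow> degree h \<le> degree s"
    using ex_has_least_nat[of ?P h0 degree] by blast
  obtain ys where ys: "h = (\<Prod>y\<leftarrow>ys. [:- y, 1:])"
    using alg_closed_splits[OF alg_closed, of h] h by auto
  have "\<exists>y\<in>set ys. N (x - y) < 1"
  proof (rule ccontr)
    assume "\<not> ?thesis"
    then have ge: "N (x - y) \<ge> 1" if "y \<in> set ys" for y using that by force
    have "N (poly (\<Prod>y\<leftarrow>ys. [:- y, 1:]) x) \<ge> 1"
      using ge
    proof (induction ys)
      case (Cons y ys)
      then have "1 * 1 \<le> N (x - y) * N (poly (\<Prod>y\<leftarrow>ys. [:- y, 1:]) x)"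
        by (intro mult_mono) auto
      moreover have "poly (\<Prod>y\<leftarrow>y # ys. [:- y, 1:]) x = (x - y) * poly (\<Prod>y\<leftarrow>ys. [:- y, 1:]) x"
        by (simp add: algebra_simps)
      ultimately show ?case by (simp only: N_mult)
    qed simp
    then show False using h ys by simp
  qed
  then obtain y where y: "y \<in> set ys" "N (x - y) < 1" by blast
  have hy: "poly h y = 0" using y(1) unfolding ys poly_prod_list_linear_0_iff .
  have Ny: "N y \<le> 1" using N_diff_le[of x 1 "x - y"] x y(2) by simp
  have "N u \<notin> N ` adjoin L y"
  proof
    assume "N u \<in> N ` adjoin L y"
    then obtain q where q: "q \<in> polys_over L" "N u = N (poly q y)" unfolding adjoin_def by auto
    obtain s t where st: "s \<in> polys_over L" "t \<in> polys_over L" "q = s * h + t"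
      "\<And>i. i \<ge> degree h \<Longrightarrow> coeff t i = 0" using polys_over_division[OF L(1) _ _ q(1), of h] h by metis
    have ut: "N u = N (poly t y)" using q(2) st(3) hy by simp
    then have "poly t y \<noteq> 0" using u(1) by (metis N_eq_0_iff)
    then have "t \<noteq> 0" by auto
    then obtain i where i: "coeff t i \<noteq> 0" "\<And>j. N (coeff t j) \<le> N (coeff t i)"
      "\<And>j. j > i \<Longrightarrow> N (coeff t j) < N (coeff t i)" using last_max_coeff by metis
    have idh: "i < degree h" using i(1) st(4) not_less by blast
    have tL: "coeff t k \<in> L" for k using st(2) by (auto simp: polys_over_def)
    \<comment> \<open>Scaling makes the last maximal coefficient 1, and everything above it is
      negligible. The truncation \<open>t''\<close> is then monic, integral and of smaller degree
      than \<open>h\<close>, so by minimality of \<open>h\<close> it cannot vanish residually at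
      \<open>x\<close>.\<close>
    define t' where "t' = smult (inverse (coeff t i)) t"
    define t'' where "t'' = poly_cutoff (Suc i) t'"
    have ti: "N (coeff t i) > 0" using i(1) by simp
    have t'N: "N (coeff t' k) = N (coeff t k) / N (coeff t i)" for k
      by (simp add: t'_def N_mult N_inverse divide_inverse mult.commute)
    have t'_le: "N (coeff t' k) \<le> 1" for k using i(2)[of k] ti by (simp add: t'N del: N_pos)
    have t'_less: "N (coeff t' k) < 1" if "k > i" for k
      using i(3)[OF that] ti by (simp add: t'N del: N_pos)
    have c'': "coeff t'' k = (if k \<le> i then coeff t' k else 0)" for k
      by (simp add: t''_def coeff_poly_cutoff)
    have c''i: "coeff t'' i = 1" using i(1) by (simp add: c'' t'_def)
    have deg: "degree t'' = i"
      by (rule antisym[OF degree_le le_degree]) (use c''i in \<open>auto simp: c''\<close>)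
    have "N (poly (t' - t'') x) < 1"
      using t'_less x by (intro N_poly_less_1) (auto simp: c'')
    moreover have "N (poly t'' x) \<ge> 1"
    proof (rule ccontr)
      assume "\<not> N (poly t'' x) \<ge> 1"
      then have "?P t''"
        using c''i deg t'_le tL L(1)
        by (auto simp: c'' polys_over_def t'_def intro!: subfield_closed)
      then show False using least[of t''] deg idh by simp
    qed
    moreover have "N (poly t' x - poly t' y) < 1" using t'_le x Ny y(2) by (intro N_poly_cong)
    ultimately have "N (poly t' y) \<ge> 1"
      using N_add_less[of "poly t' x - poly t' y" 1 "poly t' y"] N_diff_less[of "poly t' x" 1 "poly (t' - t'') x"]
      by force
    moreover have "N (poly t' y) \<le> 1" using t'_le Ny by (rule N_poly_le_1)
    ultimately have "N (poly t' y) = 1" by simp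
    then have "N u = N (coeff t i)" 
      using ut ti by (simp add: t'_def N_mult N_inverse N_divide field_simps del: N_pos)
    then show False using u(2) tL by blast
  qed
  then have "y \<in> L" by (rule adjoin_in_maximal)
  with y(2) show ?thesis using that by blast
qed

text \<open>The quotient of \<open>x ^ p ^ k\<close> by a suitable \<open>a\<close> in
  \<open>L\<close> is a unit congruent to some \<open>y\<close> in \<open>L\<close>. Since
  \<open>\<sigma>\<close> fixes \<open>a\<close> and \<open>y\<close> and preserves
  \<open>N\<close>, it fixes the residue of this unit; cancelling Frobenius gives that
  \<open>\<sigma> x / x\<close> is congruent to 1.\<close>

lemma maximal_field_wild:
  assumes \<sigma>: "\<sigma> \<in> galois_group L" and x: "x \<noteq> 0"
  shows "N (\<sigma> x - x) < N x"
proof -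
  obtain k a where a: "a \<in> L" "N a = N x ^ p ^ k" using maximal_field_values[OF x] .
  have Nx: "N x > 0" using x by simp
  then have "N a > 0" using a(2) by (simp del: N_pos)
  then have a0: "a \<noteq> 0" by simp
  have "N (x ^ p ^ k / a) = 1" using a(2) x by (simp add: N_divide N_power)
  then obtain y where y: "y \<in> L" "N (x ^ p ^ k / a - y) < 1" using maximal_field_residue[of "x ^ p ^ k / a"] by auto
  have \<sigma>K: "\<sigma> \<in> galois_group K" using \<sigma> galois_group_antimono[OF L(2)] by blast
  have c: "\<sigma> (c * d) = c * \<sigma> d" if "c \<in> L" for c d using galois_groupD(2,3)[OF \<sigma>] that by simp
  have "\<sigma> (x ^ p ^ k / a - y) = \<sigma> x ^ p ^ k / a - y"
    using c[of "inverse a" "x ^ p ^ k"] subfield_inverse[OF L(1) a(1)] galois_groupD(3)[OF \<sigma> y(1)]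
    by (simp add: galois_group_diff[OF \<sigma>] galois_group_power[OF \<sigma>] divide_inverse mult.commute)
  then have "N (\<sigma> x ^ p ^ k / a - y) < 1" using galois_N[OF \<sigma>K] y(2) by metis
  then have "N (\<sigma> x ^ p ^ k / a - x ^ p ^ k / a) < 1"
    using N_triangle_less y(2) N_diff_commute by metis
  then have "N (\<sigma> x ^ p ^ k - x ^ p ^ k) < N x ^ p ^ k"
    using \<open>N a > 0\<close> a(2) Nx by (simp add: N_divide flip: diff_divide_distrib)
  moreover have "(\<sigma> x / x) ^ p ^ k - 1 ^ p ^ k = (\<sigma> x ^ p ^ k - x ^ p ^ k) / x ^ p ^ k"
    using x by (simp add: power_divide diff_divide_distrib)
  ultimately have "N ((\<sigma> x / x) ^ p ^ k - 1 ^ p ^ k) < 1" using Nx by (simp add: N_divide N_power)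
  then have "N (\<sigma> x / x - 1) < 1"
    using galois_N[OF \<sigma>K, of x] x frobenius_cancel[of "\<sigma> x / x" 1 k] by (simp add: N_divide)
  moreover have "\<sigma> x / x - 1 = (\<sigma> x - x) / x" using x by (simp add: diff_divide_distrib)
  ultimately show ?thesis using Nx by (simp add: N_divide)
qed

end

text \<open>For separable \<open>u\<close> this follows from being fixed by wild inertia; in this form the
  condition passes to \<open>u - z\<close> with \<open>z \<in> K\<close> without rechecking separability.\<close>

definition tame :: "'a \<Rightarrow> bool" where
  "tame u \<longleftrightarrow> (\<forall>L. is_subfield L \<longrightarrow> K \<subseteq> L \<longrightarrow>
     (\<forall>\<sigma>\<in>galois_group L. \<forall>x. x \<noteq> 0 \<longrightarrow> N (\<sigma> x - x) < N x) \<longrightarrow> u \<in> L)"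

lemma tame_diff: "tame u \<Longrightarrow> z \<in> K \<Longrightarrow> tame (u - z)"
  unfolding tame_def by (meson subfield_diff subsetD)

text \<open>A field over \<open>K\<close> that is maximal among those missing the value
  \<open>N u\<close> has only wild automorphisms. Tameness would put \<open>u\<close> into this
  field, although its value does not occur there.\<close>

lemma tame_value:
  assumes "tame u" "u \<noteq> 0" "N u ^ p ^ j \<in> N ` K"
  shows "N u \<in> N ` K"
proof (rule ccontr)
  assume nu: "N u \<notin> N ` K"
  let ?A = "{L. is_subfield L \<and> K \<subseteq> L \<and> N u \<notin> N ` L}"
  have "\<exists>L\<in>?A. \<forall>X\<in>?A. L \<subseteq> X \<longrightarrow> X = L"
  proof (rule subset_Zorn_nonempty)
    show "?A \<noteq> {}" using nu subfield by auto
    fix C assume C: "C \<noteq> {}" "subset.chain ?A C"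
    then have CA: "C \<subseteq> ?A" and ch: "\<And>X Y. X \<in> C \<Longrightarrow> Y \<in> C \<Longrightarrow> X \<subseteq> Y \<or> Y \<subseteq> X"
      by (auto simp: subset_chain_def)
    have two: "\<exists>X\<in>C. a \<in> X \<and> b \<in> X" if "a \<in> \<Union>C" "b \<in> \<Union>C" for a b
      using that ch by (metis UnionE subsetD)
    have sf: "is_subfield X" if "X \<in> C" for X using that CA by auto
    have "is_subfield (\<Union>C)" unfolding is_subfield_def
    proof (intro conjI ballI)
      show "0 \<in> \<Union>C" "1 \<in> \<Union>C" using C(1) sf subfield_0 subfield_1 by blast+
      show "a + b \<in> \<Union>C" if "a \<in> \<Union>C" "b \<in> \<Union>C" for a b
        using two[OF that] sf subfield_add by (meson UnionI)
      show "a * b \<in> \<Union>C" if "a \<in> \<Union>C" "b \<in> \<Union>C" for a b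
        using two[OF that] sf subfield_mult by (meson UnionI)
      show "- a \<in> \<Union>C" if "a \<in> \<Union>C" for a
        using that sf subfield_minus by (meson UnionE UnionI)
      show "inverse a \<in> \<Union>C" if "a \<in> \<Union>C" for a
        using that sf subfield_inverse by (meson UnionE UnionI)
    qed
    moreover have "K \<subseteq> \<Union>C" using C(1) CA by blast
    moreover have "N u \<notin> N ` \<Union>C" using CA by blast
    ultimately show "\<Union>C \<in> ?A" by simp
  qed
  then obtain L where L: "is_subfield L" "K \<subseteq> L" "N u \<notin> N ` L"
    and max: "\<And>M. is_subfield M \<Longrightarrow> K \<subseteq> M \<Longrightarrow> N u \<notin> N ` M \<Longrightarrow> L \<subseteq> M \<Longrightarrow> M = L" by auto
  have "N (\<sigma> x - x) < N x" if "\<sigma> \<in> galois_group L" "x \<noteq> 0" for \<sigma> x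
    by (rule maximal_field_wild[OF L(1,2) assms(2) L(3) assms(3) _ that]) (use max L(2) in auto)
  then have "u \<in> L" using assms(1) L unfolding tame_def by blast
  then show False using L(3) by blast
qed

text \<open>If the minimal polynomial of \<open>u\<close> has degree \<open>n = p ^ j * n'\<close> with \<open>p\<close> not dividing \<open>n'\<close>, then it is
  close to \<open>(X - u) ^ n\<close>, and its coefficient at \<open>n - p ^ j\<close> gives an element of \<open>K\<close> close to
  \<open>u ^ (p ^ j)\<close> because \<open>n choose p ^ j\<close> is prime to \<open>p\<close>.\<close>

lemma tame_approx:
  assumes tame: "tame u" and u: "u \<noteq> 0" and close: "\<And>\<sigma>. \<sigma> \<in> galois_group K \<Longrightarrow> N (\<sigma> u - u) < N u"
  obtains a where "a \<in> K" "N (u - a) < N u"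
proof -
  obtain m where m: "is_min_poly K u m" using min_poly_exists[OF subfield algebraic order_refl] .
  obtain xs where xs: "length xs = degree m" "m = (\<Prod>x\<leftarrow>xs. [:- x, 1:])"
    "\<And>y. y \<in> set xs \<Longrightarrow> \<exists>\<sigma>\<in>galois_group K. \<sigma> u = y" using min_poly_conjugates[OF m] by blast
  define n where "n = degree m"
  have n: "n > 0" using is_min_polyD(4)[OF m] n_def by simp
  obtain n' where n': "n = p ^ multiplicity p n * n'" "\<not> p dvd n'"
    using n multiplicity_decompose'[of n p] prime_p by (metis not_prime_unit not_gr0)
  define j where "j = multiplicity p n"
  define Q where "Q = p ^ j"
  have nQ: "n = Q * n'" using n'(1) by (simp add: Q_def j_def)
  have n'0: "n' > 0" using n nQ by (cases n') auto
  have Qn: "Q \<le> n" using nQ n'0 by simp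
  \<comment> \<open>Taking the full power of \<open>p\<close> in \<open>n\<close> is essential here:
    a smaller power of \<open>p\<close> in place of \<open>Q\<close> would give a multiple of
    \<open>p\<close>.\<close>
  have B: "\<not> p dvd (n choose Q)"
  proof -
    have "multiplicity p (n choose Q) = multiplicity p n'"
      using const_p_fac[OF n'0 prime_p, of j] nQ Q_def by simp
    also have "\<dots> = 0" using n'(2) by (rule not_dvd_imp_multiplicity_0)
    finally show ?thesis
      using Qn prime_p by (subst (asm) multiplicity_eq_zero_iff) auto
  qed
  \<comment> \<open>The comparison term for this coefficient is the unit
    \<open>of_nat (n choose Q) * (- 1) ^ Q\<close> times \<open>u ^ Q\<close>; dividing by the unit
    isolates an approximation of \<open>u ^ Q\<close>.\<close>
  define b where "b = coeff m (n - Q) / (of_nat (n choose Q) * (- 1) ^ Q)"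
  have NB: "N (of_nat (n choose Q) * (- 1) ^ Q) = 1"
    using N_of_nat_coprime[OF B] by (simp add: N_mult N_power)
  have Bne: "of_nat (n choose Q) * (- 1) ^ Q \<noteq> (0 :: 'a)" using NB by (metis N_0 zero_neq_one)
  have bK: "b \<in> K"
    unfolding b_def using is_min_polyD(1)[OF m] subfield
    by (intro subfield_divide subfield_mult subfield_power subfield_of_nat subfield_minus subfield_1)
       (auto simp: polys_over_def)
  have "N (coeff m (n - Q) - of_nat (n choose (n - Q)) * (- u) ^ (n - (n - Q))) < N u ^ (n - (n - Q))"
    using coeff_prod_linear_close[OF u, of xs "n - Q"] xs close unfolding n_def by force
  then have "N (coeff m (n - Q) - of_nat (n choose Q) * (- u) ^ Q) < N u ^ Q"
    using Qn binomial_symmetric[OF Qn] by simp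
  also have "coeff m (n - Q) - of_nat (n choose Q) * (- u) ^ Q =
    (of_nat (n choose Q) * (- 1) ^ Q) * (b - u ^ Q)"
    using Bne by (simp add: b_def algebra_simps power_minus[of u])
  finally have bu: "N (b - u ^ Q) < N u ^ Q" using NB by (simp only: N_mult[of _ "b - u ^ Q"] mult_1)
  then have "N b = N u ^ Q" using N_eq_if_close[of "u ^ Q" b] by (simp add: N_diff_commute N_power)
  then have "N u ^ p ^ j \<in> N ` K" using bK Q_def by (metis image_eqI)
  then have "N u \<in> N ` K" by (rule tame_value[OF tame u])
  then obtain a where a: "a \<in> K" "N a = N u" by force
  have Nu: "N u > 0" using u by simp
  then have a0: "a \<noteq> 0" using a(2) by (metis N_pos)
  define w where "w = u / a"
  have Nw: "N w = 1" using a(2) Nu by (simp add: w_def N_divide)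
  have wb: "N (b / a ^ Q - w ^ Q) < 1"
    using bu a(2) Nu by (simp add: w_def power_divide N_divide N_power flip: diff_divide_distrib)
  have "b / a ^ Q \<in> K" "N (b / a ^ Q) \<le> 1"
    using bK a(1) subfield \<open>N b = N u ^ Q\<close> a(2) Nu by (auto intro: subfield_closed simp: N_divide N_power)
  \<comment> \<open>The residue of \<open>b / a ^ Q\<close> is that of \<open>(u / a) ^ Q\<close>.
    Perfectness provides a root \<open>c\<close> in \<open>K\<close>, and injectivity of Frobenius
    makes it congruent to \<open>u / a\<close>.\<close>
  then obtain c where c: "c \<in> K" "N c \<le> 1" "N (c ^ p ^ j - b / a ^ Q) < 1" using frobenius_root by metis
  then have "N (c ^ p ^ j - w ^ p ^ j) < 1" using wb N_triangle_less unfolding Q_def by blast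
  then have "N (c - w) < 1" using c(2) Nw frobenius_cancel[of c w j] by simp
  then have "N (a * (w - c)) < N u" using a(2) Nu by (simp add: N_mult N_diff_commute)
  moreover have "a * (w - c) = u - a * c" using a0 by (simp add: w_def algebra_simps)
  ultimately show ?thesis using that[of "a * c"] a(1) c(1) subfield_mult[OF subfield] by simp
qed

text \<open>As long as \<open>z\<close> is farther than \<open>\<delta>\<close> from
  \<open>r\<close>, the conjugates of \<open>r - z\<close> are closer to it than 0 is, so
  \<open>z\<close> can be improved. Discreteness at least halves the distance each time, and it must
  fall below \<open>\<delta>\<close>.\<close>

lemma tame_center:
  assumes tame: "tame r" and \<delta>: "\<delta> > 0" and close: "\<And>\<sigma>. \<sigma> \<in> galois_group K \<Longrightarrow> N (\<sigma> r - r) \<le> \<delta>"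
  obtains z where "z \<in> K" "N (r - z) \<le> \<delta>"
proof (rule ccontr)
  assume "\<not> thesis"
  then have far: "N (r - z) > \<delta>" if "z \<in> K" for z using that \<open>\<And>z. z \<in> K \<Longrightarrow> N (r - z) \<le> \<delta> \<Longrightarrow> thesis\<close>
    by force
  have step: "\<exists>a\<in>K. N (r - z - a) < N (r - z)" if z: "z \<in> K" for z
  proof -
    have "N (\<sigma> (r - z) - (r - z)) < N (r - z)" if \<sigma>: "\<sigma> \<in> galois_group K" for \<sigma>
      using close[OF \<sigma>] far[OF z] galois_groupD(3)[OF \<sigma> z] by (simp add: galois_group_diff[OF \<sigma>])
    moreover have "r - z \<noteq> 0" using far[OF z] \<delta> by (metis N_0 less_asym)
    ultimately show ?thesis using tame_approx[OF tame_diff[OF tame z]] by blast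
  qed
  \<comment> \<open>Discreteness concerns elements of \<open>K\<close> only, so the distances
    \<open>N (r - z)\<close> must be realised as values of \<open>K\<close> before they can be
    compared.\<close>
  have val: "\<exists>a\<in>K. N a = N (r - z)" if z: "z \<in> K" for z
    using step[OF z] N_eq_if_close by blast
  have "\<exists>z\<in>K. N (r - z) \<le> N r / 2 ^ k" for k
  proof (induction k)
    case 0
    show ?case by (intro bexI[of _ 0]) (auto intro: subfield_0[OF subfield])
  next
    case (Suc k)
    then obtain z where z: "z \<in> K" "N (r - z) \<le> N r / 2 ^ k" by blast
    obtain a where a: "a \<in> K" "N (r - z - a) < N (r - z)" using step[OF z(1)] by blast
    have za: "z + a \<in> K" using z(1) a(1) by (rule subfield_add[OF subfield])
    obtain b b' where b: "b \<in> K" "N b = N (r - z)" "b' \<in> K" "N b' = N (r - (z + a))"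
      using val[OF z(1)] val[OF za] by blast
    have "N b' < N b" using a(2) b by (simp add: algebra_simps)
    then have "N b' \<le> N b / 2" using discrete b by blast
    also have "\<dots> \<le> N r / 2 ^ k / 2" unfolding b(2) by (rule divide_right_mono[OF z(2)]) simp
    finally have "N (r - (z + a)) \<le> N r / 2 ^ Suc k" unfolding b(4) by (simp add: mult.commute)
    then show ?case using za by blast
  qed
  then have ex: "\<exists>z\<in>K. N (r - z) \<le> N r / 2 ^ k" for k .
  obtain k where "N r / \<delta> < 2 ^ k" using real_arch_pow[of 2] by auto
  then have "N r / 2 ^ k < \<delta>" using \<delta> by (simp add: field_simps)
  then show False using ex[of k] far by force
qed

end

subsection \<open>Gauss's lemma\<close>

context nonarch_abs
begin

text \<open>No cancellation can hide the largest coefficient of \<open>q\<close>: if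
  \<open>N r \<le> 1\<close>, the last maximal one survives one place higher; otherwise the first
  maximal one survives in place, multiplied by \<open>r\<close>. Common bounds on the coefficients
  stand in for the Gauss norm.\<close>

lemma gauss_linear:
  assumes "0 \<le> B"
  shows "(\<forall>i. N (coeff ([:- r, 1:] * q) i) \<le> B) \<longleftrightarrow> (\<forall>i. max 1 (N r) * N (coeff q i) \<le> B)"
proof -
  have c: "coeff ([:- r, 1:] * q) i = (case i of 0 \<Rightarrow> 0 | Suc k \<Rightarrow> coeff q k) - r * coeff q i" for i
    by (simp add: coeff_pCons split: nat.splits)
  show ?thesis
  proof
    assume *: "\<forall>i. max 1 (N r) * N (coeff q i) \<le> B"
    have 1: "N (coeff q i) \<le> B" for i
    proof -
      have "1 * N (coeff q i) \<le> max 1 (N r) * N (coeff q i)" by (intro mult_right_mono) auto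
      with * show ?thesis by (metis mult_1 order_trans)
    qed
    have 2: "N (r * coeff q i) \<le> B" for i
    proof -
      have "N r * N (coeff q i) \<le> max 1 (N r) * N (coeff q i)" by (intro mult_right_mono) auto
      with * show ?thesis by (metis N_mult order_trans)
    qed
    show "\<forall>i. N (coeff ([:- r, 1:] * q) i) \<le> B"
      unfolding c using 1 2 assms by (auto intro!: N_diff_le split: nat.splits)
  next
    assume *: "\<forall>i. N (coeff ([:- r, 1:] * q) i) \<le> B"
    show "\<forall>i. max 1 (N r) * N (coeff q i) \<le> B"
    proof (cases "q = 0")
      case True
      then show ?thesis using assms by simp
    next
      case q: False
      have "\<exists>i. (\<forall>j. N (coeff q j) \<le> N (coeff q i)) \<and> max 1 (N r) * N (coeff q i) \<le> B"
      proof (cases "N r \<le> 1")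
        case True
        obtain i where i: "coeff q i \<noteq> 0" "\<And>j. N (coeff q j) \<le> N (coeff q i)"
          "\<And>j. j > i \<Longrightarrow> N (coeff q j) < N (coeff q i)" using last_max_coeff[OF q] by metis
        have "N (r * coeff q (Suc i)) \<le> 1 * N (coeff q (Suc i))"
          unfolding N_mult using True by (intro mult_right_mono) auto
        also have "\<dots> < N (coeff q i)" using i(3)[of "Suc i"] by simp
        finally have "N (coeff q i + - (r * coeff q (Suc i))) = N (coeff q i)"
          by (intro N_add_eq) simp
        then have "N (coeff q i) \<le> B" using *[rule_format, of "Suc i"] unfolding c by simp
        then show ?thesis using i True by (intro exI[of _ i]) (auto simp: max_def)
      next
        case False
        obtain i where i: "coeff q i \<noteq> 0" "\<And>j. N (coeff q j) \<le> N (coeff q i)"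
          "\<And>j. j < i \<Longrightarrow> N (coeff q j) < N (coeff q i)" using first_max_coeff[OF q] by metis
        have pos: "N (coeff q i) > 0" using i(1) by simp
        have "N (case i of 0 \<Rightarrow> 0 | Suc k \<Rightarrow> coeff q k) \<le> 1 * N (coeff q i)"
          using i(2)[of "i - 1"] by (cases i) auto
        also have "\<dots> < N r * N (coeff q i)"
          using False pos by (intro mult_strict_right_mono) auto
        finally have "N (case i of 0 \<Rightarrow> 0 | Suc k \<Rightarrow> coeff q k) < N (- (r * coeff q i))"
          by (simp add: N_mult)
        then have "N (- (r * coeff q i) + (case i of 0 \<Rightarrow> 0 | Suc k \<Rightarrow> coeff q k)) = N (- (r * coeff q i))"
          by (rule N_add_eq)
        then have "N r * N (coeff q i) \<le> B" using *[rule_format, of i] unfolding c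
          by (simp add: N_mult add.commute)
        then show ?thesis using i False by (intro exI[of _ i]) (auto simp: max_def)
      qed
      then obtain i where i: "\<And>j. N (coeff q j) \<le> N (coeff q i)" "max 1 (N r) * N (coeff q i) \<le> B"
        by blast
      have "max 1 (N r) * N (coeff q j) \<le> max 1 (N r) * N (coeff q i)" for j
        using i(1)[of j] by (intro mult_left_mono) auto
      then show ?thesis using i(2) order_trans by blast
    qed
  qed
qed

text \<open>Each linear factor divides the admissible bound by its own norm, so \<open>B\<close> has
  to vary in the induction. The map \<open>h\<close> allows for translated roots.\<close>

lemma gauss_prod:
  assumes "finite R" "0 \<le> B"
  shows "(\<forall>i. N (coeff (smult c (\<Prod>r\<in>R. [:- h r, 1:])) i) \<le> B) \<longleftrightarrow> N c * (\<Prod>r\<in>R. max 1 (N (h r))) \<le> B"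
  using assms
proof (induction R arbitrary: B rule: finite_induct)
  case empty
  then show ?case by (auto simp: coeff_pCons dest: spec[of _ 0] split: nat.splits)
next
  case (insert r R)
  let ?q = "smult c (\<Prod>r\<in>R. [:- h r, 1:])" and ?M = "max 1 (N (h r))"
  have M: "?M > 0" by simp
  have "smult c (\<Prod>r\<in>insert r R. [:- h r, 1:]) = [:- h r, 1:] * ?q"
    using insert.hyps by (simp only: prod.insert[OF insert.hyps] mult_smult_right)
  then have "(\<forall>i. N (coeff (smult c (\<Prod>r\<in>insert r R. [:- h r, 1:])) i) \<le> B) \<longleftrightarrow>
    (\<forall>i. ?M * N (coeff ?q i) \<le> B)" using gauss_linear[OF insert.prems] by metis
  also have "\<dots> \<longleftrightarrow> (\<forall>i. N (coeff ?q i) \<le> B / ?M)" using M by (simp only: pos_le_divide_eq mult.commute)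
  also have "\<dots> \<longleftrightarrow> N c * (\<Prod>r\<in>R. max 1 (N (h r))) \<le> B / ?M"
    using insert.prems M by (intro insert.IH) simp
  also have "\<dots> \<longleftrightarrow> N c * (\<Prod>r\<in>insert r R. max 1 (N (h r))) \<le> B"
    using M by (simp only: prod.insert[OF insert.hyps] pos_le_divide_eq mult_ac)
  finally show ?case .
qed

end

subsection \<open>Clusters\<close>

text \<open>Base 2 turns one step of the integer-valued valuation on \<open>K\<close> into a factor
  1/2, as \<open>discrete\<close> demands. Zero is treated separately because
  \<open>real_of_ereal\<close> sends infinity to 0.\<close>

definition absv :: "('a::field \<Rightarrow> ereal) \<Rightarrow> 'a \<Rightarrow> real" where
  "absv v x = (if x = 0 then 0 else 2 powr (- real_of_ereal (v x)))"

locale valuation =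
  fixes v :: "'a::field \<Rightarrow> ereal"
  assumes val: "is_valuation v"
begin

lemma v_infty_iff [simp]: "v x = \<infinity> \<longleftrightarrow> x = 0"
  and v_neq_minus_infty [simp]: "v x \<noteq> - \<infinity>"
  and v_mult: "v (x * y) = v x + v y"
  and v_add: "min (v x) (v y) \<le> v (x + y)"
  using val unfolding is_valuation_def by auto

lemma v_0 [simp]: "v 0 = \<infinity>" by simp

lemma v_finite: "x \<noteq> 0 \<Longrightarrow> ereal (real_of_ereal (v x)) = v x"
  using v_infty_iff[of x] v_neq_minus_infty[of x] by (cases "v x") auto

lemma nonarch_abs_absv: "nonarch_abs (absv v)"
proof
  fix x y
  show "absv v x = 0 \<longleftrightarrow> x = 0" "0 \<le> absv v x" by (auto simp: absv_def)
  show "absv v (x * y) = absv v x * absv v y"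
  proof (cases "x = 0 \<or> y = 0")
    case True
    then show ?thesis by (auto simp: absv_def)
  next
    case False
    then have "v (x * y) = ereal (real_of_ereal (v x) + real_of_ereal (v y))"
      using v_mult[of x y] v_finite[of x] v_finite[of y] by (metis plus_ereal.simps(1))
    then show ?thesis using False by (simp add: absv_def flip: powr_add)
  qed
  show "absv v (x + y) \<le> max (absv v x) (absv v y)"
  proof (cases "x = 0 \<or> y = 0 \<or> x + y = 0")
    case True
    then show ?thesis by (auto simp: absv_def le_max_iff_disj)
  next
    case False
    then have "v x = ereal (real_of_ereal (v x))" "v y = ereal (real_of_ereal (v y))"
      "v (x + y) = ereal (real_of_ereal (v (x + y)))" using v_finite by auto
    then have "min (real_of_ereal (v x)) (real_of_ereal (v y)) \<le> real_of_ereal (v (x + y))"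
      using v_add[of x y] by (metis ereal_less_eq(3) ereal_min)
    then show ?thesis using False by (auto simp: absv_def min_def split: if_splits)
  qed
qed

sublocale abs: nonarch_abs "absv v"
  by (rule nonarch_abs_absv)

lemma absv_le_iff: "absv v x \<le> absv v y \<longleftrightarrow> v y \<le> v x"
proof (cases "x = 0 \<or> y = 0")
  case True
  then show ?thesis by (auto simp: absv_def not_le)
next
  case False
  then have "v y \<le> v x \<longleftrightarrow> real_of_ereal (v y) \<le> real_of_ereal (v x)"
    using v_finite by (metis ereal_less_eq(3))
  then show ?thesis using False by (simp add: absv_def)
qed

lemma absv_less_iff: "absv v x < absv v y \<longleftrightarrow> v y < v x"
  using absv_le_iff[of y x] by (simp add: not_le[symmetric])

lemma absv_le_powr_iff: "absv v x \<le> 2 powr (- d) \<longleftrightarrow> ereal d \<le> v x"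
proof (cases "x = 0")
  case True
  then show ?thesis by (auto simp: absv_def)
next
  case False
  then have "ereal d \<le> v x \<longleftrightarrow> d \<le> real_of_ereal (v x)"
    using v_finite by (metis ereal_less_eq(3))
  then show ?thesis using False by (simp add: absv_def)
qed

lemma v_1: "v 1 = 0"
  using absv_le_iff[of 1 1] abs.N_1 v_finite[of 1] by (simp add: absv_def zero_ereal_def)

lemma absv_le_1_iff: "absv v x \<le> 1 \<longleftrightarrow> 0 \<le> v x"
  using absv_le_iff[of x 1] v_1 by simp

lemma absv_less_1_iff: "absv v x < 1 \<longleftrightarrow> 0 < v x"
  using absv_less_iff[of x 1] v_1 by simp

lemma v_diff_commute: "v (x - y) = v (y - x)"
  using absv_le_iff[of "x - y" "y - x"] absv_le_iff[of "y - x" "x - y"] abs.N_diff_commute[of x y] by simp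

lemma v_triangle: "min (v (x - y)) (v (y - z)) \<le> v (x - z)"
  using v_add[of "x - y" "y - z"] by simp

lemma v_triangle_le: "d \<le> v (x - y) \<Longrightarrow> d \<le> v (y - z) \<Longrightarrow> d \<le> v (x - z)"
  using v_triangle[of x y z] by (meson min.boundedI order_trans)

lemma v_triangle_less: "d < v (x - y) \<Longrightarrow> d < v (y - z) \<Longrightarrow> d < v (x - z)"
  using v_triangle[of x y z] by (meson less_le_trans min_less_iff_conj)

text \<open>The exponent of the Gauss factor \<open>max 1 (absv v x)\<close>. The cap at 0 also
  removes the infinite value at \<open>x = 0\<close>, so sums over roots stay real.\<close>

definition vneg :: "'a \<Rightarrow> real" where
  "vneg x = real_of_ereal (min 0 (v x))"

lemma ereal_vneg: "ereal (vneg x) = min 0 (v x)"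
  using v_neq_minus_infty[of x] by (cases "v x") (auto simp: vneg_def min_def)

lemma vneg_ge_iff: "d \<le> vneg x \<longleftrightarrow> d \<le> 0 \<and> ereal d \<le> v x"
proof -
  have "d \<le> vneg x \<longleftrightarrow> ereal d \<le> ereal (vneg x)" by simp
  then show ?thesis unfolding ereal_vneg by simp
qed

lemma max_1_absv: "max 1 (absv v x) = 2 powr (- vneg x)"
proof (cases "x = 0")
  case True
  then show ?thesis by (simp add: vneg_def absv_def)
next
  case False
  then have "vneg x = min 0 (real_of_ereal (v x))"
    using ereal_vneg[of x] v_finite[OF False] by (metis ereal_min ereal.inject zero_ereal_def)
  moreover have "max 1 (2 powr (- w)) = (2::real) powr (- min 0 w)" for w
    using powr_le_cancel_iff[of 2 0 "- w"] by (cases "w \<le> 0") (simp_all add: max_def)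
  ultimately show ?thesis using False by (simp add: absv_def)
qed

lemma integral_prod_linear_iff:
  assumes "finite R" "c \<noteq> 0"
  shows "integral_poly v (smult c (\<Prod>r\<in>R. [:- h r, 1:])) \<longleftrightarrow> 0 \<le> real_of_ereal (v c) + (\<Sum>r\<in>R. vneg (h r))"
proof -
  have "absv v c * (\<Prod>r\<in>R. max 1 (absv v (h r))) = 2 powr (- (real_of_ereal (v c) + (\<Sum>r\<in>R. vneg (h r))))"
  proof -
    have "(\<Prod>r\<in>R. max 1 (absv v (h r))) = 2 powr (- (\<Sum>r\<in>R. vneg (h r)))"
      using assms(1) by (simp add: max_1_absv powr_sum flip: sum_negf)
    then show ?thesis using assms(2) by (simp add: absv_def flip: powr_add)
  qed
  then have "absv v c * (\<Prod>r\<in>R. max 1 (absv v (h r))) \<le> 1 \<longleftrightarrow>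
    0 \<le> real_of_ereal (v c) + (\<Sum>r\<in>R. vneg (h r))"
    using powr_le_cancel_iff[of 2 "- (real_of_ereal (v c) + (\<Sum>r\<in>R. vneg (h r)))" 0] by (simp, linarith)
  then show ?thesis
    unfolding integral_poly_def absv_le_1_iff[symmetric] using abs.gauss_prod[OF assms(1), of 1] by simp
qed

lemma
  assumes s: "finite s" "card s > 1"
  shows depth_attained: "\<exists>a\<in>s. \<exists>b\<in>s. a \<noteq> b \<and> ereal (depth v s) = v (a - b)"
    and depth_le: "a \<in> s \<Longrightarrow> b \<in> s \<Longrightarrow> ereal (depth v s) \<le> v (a - b)"
proof -
  let ?D = "{v (r - r') | r r'. r \<in> s \<and> r' \<in> s \<and> r \<noteq> r'}"
  have "?D \<subseteq> (\<lambda>(r, r'). v (r - r')) ` (s \<times> s)" by auto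
  then have fin: "finite ?D" using s(1) by (meson finite_SigmaI finite_imageI finite_subset)
  obtain x y where "x \<in> s" "y \<in> s" "x \<noteq> y"
    using s by (metis card_le_Suc0_iff_eq One_nat_def not_less)
  then have "?D \<noteq> {}" by blast
  then have "Min ?D \<in> ?D" using fin by (rule Min_in[rotated])
  then obtain x y where xy: "x \<in> s" "y \<in> s" "x \<noteq> y" "Min ?D = v (x - y)" by auto
  then have d: "ereal (depth v s) = v (x - y)" unfolding depth_def using v_finite[of "x - y"] by simp
  then show "\<exists>a\<in>s. \<exists>b\<in>s. a \<noteq> b \<and> ereal (depth v s) = v (a - b)" using xy by blast
  show "ereal (depth v s) \<le> v (a - b)" if "a \<in> s" "b \<in> s"
  proof (cases "a = b")
    case False
    then have "Min ?D \<le> v (a - b)" using that by (intro Min_le[OF fin]) auto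
    then show ?thesis using d xy(4) by simp
  qed simp
qed

lemma depth_eqI:
  assumes "finite s" "a \<in> s" "b \<in> s" "v (a - b) = ereal d" "\<And>x y. x \<in> s \<Longrightarrow> y \<in> s \<Longrightarrow> ereal d \<le> v (x - y)"
  shows "depth v s = d"
proof -
  have "a \<noteq> b" using assms(4) by auto
  then have c: "card s > 1" using assms by (intro card_gt_1I)
  obtain x y where "x \<in> s" "y \<in> s" "ereal (depth v s) = v (x - y)" using depth_attained[OF assms(1) c] by blast
  then have "ereal d \<le> ereal (depth v s)" using assms(5) by simp
  moreover have "ereal (depth v s) \<le> ereal d" using depth_le[OF assms(1) c assms(2,3)] assms(4) by simp
  ultimately show ?thesis by simp
qed

lemma clustersD: "s \<in> clusters v f \<Longrightarrow> s \<noteq> {}" "s \<in> clusters v f \<Longrightarrow> s \<subseteq> roots_of f"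
  by (auto simp: clusters_def)

text \<open>A disc containing \<open>a\<close> and \<open>b\<close> contains every point that is no
  farther from \<open>a\<close> than \<open>b\<close> is.\<close>

lemma cluster_closed:
  assumes "s \<in> clusters v f" "a \<in> s" "b \<in> s" "x \<in> roots_of f" "v (a - b) \<le> v (x - a)"
  shows "x \<in> s"
proof -
  obtain z d where s: "s = {x. ereal d \<le> v (x - z)} \<inter> roots_of f"
    using assms(1) by (auto simp: clusters_def)
  have "ereal d \<le> v (a - b)"
    using assms(2,3) v_diff_commute[of z b] s by (intro v_triangle_le[of _ a z b]) auto
  then have "ereal d \<le> v (x - z)"
    using assms(2,5) s by (intro v_triangle_le[of _ x a z]) auto
  then show ?thesis using assms(4) s by simp
qed

text \<open>The wedge is cut out by the disc around \<open>r\<close> whose radius is the distance to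
  \<open>r0\<close>: by the ultrametric inequality it contains \<open>s\<close>, and every cluster
  containing \<open>r\<close> and \<open>r0\<close> contains it. Its depth is attained by this
  pair.\<close>

lemma
  assumes f: "f \<noteq> 0" and s: "s \<in> clusters v f" and r0: "r0 \<in> s" and r: "r \<in> roots_of f - s"
  shows v_outside_cluster: "r' \<in> s \<Longrightarrow> v (r - r0) < v (r' - r0)"
    and depth_wedge: "ereal (depth v (cluster_wedge v f r s)) = v (r - r0)"
proof -
  have fin: "finite (roots_of f)" unfolding roots_of_def by (rule poly_roots_finite[OF f])
  show out: "v (r - r0) < v (r' - r0)" if "r' \<in> s" for r'
    using cluster_closed[OF s r0 that, of r] r v_diff_commute[of r0 r'] by (auto simp: not_le[symmetric])
  define d where "d = real_of_ereal (v (r - r0))"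
  have d: "v (r - r0) = ereal d" unfolding d_def using r r0 by (subst v_finite) auto
  define W where "W = {x. ereal d \<le> v (x - r)} \<inter> roots_of f"
  have rW: "r \<in> W" using r by (simp add: W_def)
  have sW: "s \<subseteq> W"
  proof
    fix r' assume r': "r' \<in> s"
    have "ereal d \<le> v (r' - r)"
      using out[OF r'] d v_diff_commute[of r0 r] by (intro v_triangle_le[of _ r' r0 r]) auto
    then show "r' \<in> W" using r' clustersD(2)[OF s] by (auto simp: W_def)
  qed
  have Wcl: "W \<in> clusters v f" using rW unfolding clusters_def W_def by blast
  have min: "W \<subseteq> c'" if c': "c' \<in> clusters v f" "insert r s \<subseteq> c'" for c'
  proof
    fix x assume "x \<in> W"
    then show "x \<in> c'" using c' r0 d by (intro cluster_closed[OF c'(1), of r r0 x]) (auto simp: W_def)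
  qed
  have "cluster_wedge v f r s = W" unfolding cluster_wedge_def
  proof (rule the_equality)
    show "W \<in> clusters v f \<and> insert r s \<subseteq> W \<and> (\<forall>c'\<in>clusters v f. insert r s \<subseteq> c' \<longrightarrow> W \<subseteq> c')"
      using Wcl rW sW min by auto
  next
    fix c assume "c \<in> clusters v f \<and> insert r s \<subseteq> c \<and> (\<forall>c'\<in>clusters v f. insert r s \<subseteq> c' \<longrightarrow> c \<subseteq> c')"
    then show "c = W" using Wcl rW sW min by (metis insert_subsetI subset_antisym)
  qed
  moreover have "depth v W = d"
  proof (rule depth_eqI)
    show "finite W" using fin by (auto simp: W_def)
    show "r \<in> W" "r0 \<in> W" using rW sW r0 by auto
    show "v (r - r0) = ereal d" by (rule d)
    fix x y assume "x \<in> W" "y \<in> W"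
    then show "ereal d \<le> v (x - y)"
      using v_diff_commute[of r y] by (intro v_triangle_le[of _ x r y]) (auto simp: W_def)
  qed
  ultimately show "ereal (depth v (cluster_wedge v f r s)) = v (r - r0)" using d by simp
qed

text \<open>Let \<open>D m\<close> consist of the roots on which \<open>min 0 v\<close> is maximal. Either \<open>D m\<close> itself is the required
  cluster with \<open>t = {}\<close>, or it is the child \<open>t\<close> of the next larger disc \<open>D m'\<close> around \<open>0\<close>.\<close>

lemma integral_pair_if_sum_nonneg:
  assumes f: "f \<noteq> 0" and fK: "f \<in> polys_over K"
    and inv: "\<And>\<sigma> x. \<sigma> \<in> galois_group K \<Longrightarrow> v (\<sigma> x) = v x"
    and card: "card (roots_of f) > 1"
    and sum: "0 \<le> n + (\<Sum>r\<in>roots_of f. vneg r)"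
  shows "integral_pair K v f n"
proof -
  define R where "R = roots_of f"
  have fin: "finite R" unfolding R_def roots_of_def by (rule poly_roots_finite[OF f])
  have Rne: "R \<noteq> {}" using card R_def by auto
  define D where "D d = {x. ereal d \<le> v (x - 0)} \<inter> R" for d
  have D_iff: "x \<in> D d \<longleftrightarrow> x \<in> R \<and> ereal d \<le> v x" for x d by (auto simp: D_def)
  have D_fin: "finite (D d)" for d using fin by (simp add: D_def)
  have D_cl: "D d \<in> clusters v f" if "D d \<noteq> {}" for d
    using that unfolding clusters_def D_def R_def by blast
  have D_stable: "G_stable (galois_group K) (D d)" for d
    unfolding G_stable_def
  proof
    fix \<sigma> assume \<sigma>: "\<sigma> \<in> galois_group K"
    have "\<sigma> x \<in> R" if "x \<in> R" for x
      using that galois_group_poly[OF \<sigma> fK, of x] galois_group_0[OF \<sigma>] by (simp add: R_def roots_of_def)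
    then have "\<sigma> ` D d \<subseteq> D d" using inv[OF \<sigma>] by (auto simp: D_iff)
    then show "\<sigma> ` D d = D d"
      using D_fin galois_groupD(4)[OF \<sigma>] by (intro endo_inj_surj) (auto intro: inj_on_subset)
  qed
  have D_diff: "ereal d \<le> v (x - y)" if "x \<in> D d" "y \<in> D d" for x y d
    using that v_triangle_le[of "ereal d" x 0 y] v_diff_commute[of 0 y] by (simp add: D_iff)
  have v_diff: "v (r - r0) = v r" if "v r < v r0" for r r0
    using abs.N_add_eq[of "- r0" r] that absv_less_iff[of r0 r] absv_le_iff[of "r - r0" r]
      absv_le_iff[of r "r - r0"] by simp
  \<comment> \<open>A root outside the disc has smaller valuation than those inside, so its distance
    to them is its distance to 0. Hence the wedge terms are exactly the terms of the Gauss
    sum.\<close>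
  have wedge: "depth v (cluster_wedge v f r (D d)) = vneg r" if "D d \<noteq> {}" "d \<le> 0" "r \<in> R - D d" for r d
  proof -
    obtain r0 where r0: "r0 \<in> D d" using \<open>D d \<noteq> {}\<close> by blast
    have r: "v r < ereal d" using that(3) by (auto simp: D_iff)
    also have "\<dots> \<le> v r0" using r0 by (simp add: D_iff)
    finally have "ereal (depth v (cluster_wedge v f r (D d))) = v r"
      using depth_wedge[OF f D_cl[OF that(1)] r0, of r] that(3) v_diff by (simp add: R_def)
    moreover have "v r \<le> 0"
      by (rule order_trans[OF less_imp_le[OF r]]) (use that(2) in simp)
    ultimately have "ereal (depth v (cluster_wedge v f r (D d))) = ereal (vneg r)"
      unfolding ereal_vneg by (simp add: min_def)
    then show ?thesis by simp
  qed
  define m where "m = Max (vneg ` R)"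
  have m_ge: "vneg r \<le> m" if "r \<in> R" for r unfolding m_def using fin that by (intro Max_ge) auto
  have "m \<in> vneg ` R" unfolding m_def using fin Rne by (intro Max_in) auto
  then obtain r0 where r0: "r0 \<in> R" "vneg r0 = m" by blast
  have m0: "m \<le> 0" using r0(2) vneg_ge_iff[of m r0] by simp
  have C_iff: "x \<in> D m \<longleftrightarrow> x \<in> R \<and> vneg x = m" for x
    using m_ge[of x] vneg_ge_iff[of m x] m0 by (auto simp: D_iff)
  have r0C: "r0 \<in> D m" using r0 C_iff by simp
  then have Cne: "D m \<noteq> {}" by blast
  have n0: "0 \<le> n"
  proof -
    have "(\<Sum>r\<in>R. vneg r) \<le> 0" using m_ge m0 by (intro sum_nonpos) force
    then show ?thesis using sum R_def by simp
  qed
  have split: "(\<Sum>r\<in>R. vneg r) = (\<Sum>r\<in>A. vneg r) + (\<Sum>r\<in>R - A. vneg r)" if "A \<subseteq> R" for A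
    using sum.subset_diff[OF that fin, of vneg] by simp
  have sumC: "(\<Sum>r\<in>D m. vneg r) = real (card (D m)) * m" using C_iff by simp
  show ?thesis
  proof (cases "card (D m) = 1 \<or> 0 \<le> depth v (D m)")
    case False
    have "card (D m) \<noteq> 0" using Cne D_fin by simp
    then have c1: "card (D m) > 1" using False by linarith
    \<comment> \<open>Replacing \<open>m\<close> by the depth of \<open>D m\<close> can therefore
      only increase the sum.\<close>
    have "m \<le> depth v (D m)"
      using depth_attained[OF D_fin c1] D_diff[of _ m] by (metis ereal_less_eq(3))
    then have "real (card (D m)) * m \<le> real (card (D m)) * depth v (D m)" by (intro mult_left_mono) auto
    moreover have "(\<Sum>r\<in>R - D m. depth v (cluster_wedge v f r (D m))) = (\<Sum>r\<in>R - D m. vneg r)"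
      using wedge[OF Cne m0] by (intro sum.cong) auto
    ultimately have "0 \<le> n + (real (card (D m)) - real (card {})) * depth v (D m)
        + (\<Sum>r\<in>R - D m. depth v (cluster_wedge v f r (D m)))"
      using sum split[of "D m"] sumC by (simp add: R_def[symmetric] D_def)
    then show ?thesis unfolding integral_pair_def R_def[symmetric]
      using False c1 D_cl[OF Cne] D_stable by (intro disjI2 bexI[of _ "D m"]) auto
  next
    case True
    show ?thesis
    proof (cases "D m = R")
      case Req: True
      then have "0 \<le> depth v R" using True card R_def by auto
      then show ?thesis using n0 unfolding integral_pair_def R_def by blast
    next
      case False
      then have RC: "R - D m \<noteq> {}" by (auto simp: D_def)
      define m' where "m' = Max (vneg ` (R - D m))"
      have "m' \<in> vneg ` (R - D m)" unfolding m'_def using fin RC by (intro Max_in) auto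
      then obtain r1 where r1: "r1 \<in> R - D m" "vneg r1 = m'" by blast
      have m'_ge: "vneg r \<le> m'" if "r \<in> R - D m" for r
        unfolding m'_def using fin that by (intro Max_ge) auto
      have m'm: "m' < m" using r1 m_ge[of r1] C_iff by force
      have S_iff: "x \<in> D m' \<longleftrightarrow> x \<in> R \<and> m' \<le> vneg x" for x
        using vneg_ge_iff[of m' x] m0 m'm by (auto simp: D_iff)
      have "D m \<subseteq> D m'" using m'm by (auto simp: S_iff C_iff)
      moreover have "r1 \<in> D m'" using r1 by (simp add: S_iff)
      ultimately have CS: "D m \<subset> D m'" using r1(1) by blast
      have Sne: "D m' \<noteq> {}" using CS by auto
      have vr1: "v r1 = ereal m'"
        using r1(2) ereal_vneg[of r1] m0 m'm by (auto simp: min_def split: if_splits)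
      have "ereal m' < ereal m" using m'm by simp
      also have "\<dots> \<le> v r0" using r0C by (simp add: D_iff)
      finally have vr0: "ereal m' < v r0" .
      then have r10: "v (r1 - r0) = ereal m'" using v_diff vr1 by simp
      have mem: "r1 \<in> D m'" "r0 \<in> D m'" using r1 r0C S_iff CS by auto
      have dS: "depth v (D m') = m'"
        using D_fin mem r10 D_diff[of _ m'] by (intro depth_eqI)
      have "r1 \<noteq> r0" using r10 by auto
      then have c1: "card (D m') > 1" using D_fin mem by (intro card_gt_1I)
      have child: "is_child v f (D m) (D m')" unfolding is_child_def
      proof (intro conjI)
        show "\<not> (\<exists>u\<in>clusters v f. D m \<subset> u \<and> u \<subset> D m')"
        proof
          assume "\<exists>u\<in>clusters v f. D m \<subset> u \<and> u \<subset> D m'"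
          then obtain u where u: "u \<in> clusters v f" "D m \<subset> u" "u \<subset> D m'" by blast
          \<comment> \<open>Such a \<open>y\<close> has valuation exactly \<open>m'\<close>, so it
            is as far from \<open>r0\<close> as two roots in \<open>D m'\<close> can be; a cluster
            containing both swallows \<open>D m'\<close>.\<close>
          then obtain y where y: "y \<in> u" "y \<notin> D m" by blast
          then have yS: "y \<in> D m'" using u by blast
          then have "vneg y = m'" using m'_ge[of y] S_iff y(2) by force
          then have vy: "v y = ereal m'"
            using ereal_vneg[of y] m0 m'm by (auto simp: min_def split: if_splits)
          then have "v (r0 - y) = ereal m'" using vr0 v_diff v_diff_commute[of r0 y] by simp
          then have "D m' \<subseteq> u"
            using cluster_closed[OF u(1), of r0 y] u(2) r0C y(1) D_diff[OF _ mem(2)]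
            by (auto simp: D_def R_def)
          then show False using u(3) by blast
        qed
      qed (use CS D_cl[OF Cne] in auto)
      have "(\<Sum>r\<in>R - D m'. depth v (cluster_wedge v f r (D m'))) = (\<Sum>r\<in>R - D m'. vneg r)"
        using wedge[OF Sne] m0 m'm by (intro sum.cong) auto
      moreover have "(\<Sum>r\<in>D m'. vneg r) = (\<Sum>r\<in>D m' - D m. vneg r) + (\<Sum>r\<in>D m. vneg r)"
        using CS D_fin by (intro sum.subset_diff) auto
      moreover have "(\<Sum>r\<in>D m' - D m. vneg r) = (\<Sum>r\<in>D m' - D m. m')"
        using m'_ge S_iff by (intro sum.cong refl antisym) auto
      moreover have "real (card (D m' - D m)) = real (card (D m')) - real (card (D m))"
        using CS D_fin by (subst card_Diff_subset) (auto simp: card_mono of_nat_diff)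
      \<comment> \<open>The integrality expression counts 0 for each root of the child, where the
        Gauss sum counts \<open>m \<le> 0\<close>.\<close>
      moreover have "real (card (D m)) * m \<le> 0" using m0 by (simp add: mult_nonneg_nonpos)
      moreover have "(\<Sum>r\<in>R. vneg r) = (\<Sum>r\<in>D m'. vneg r) + (\<Sum>r\<in>R - D m'. vneg r)"
        by (rule split) (simp add: D_def)
      ultimately have le: "0 \<le> n + (real (card (D m')) - real (card (D m))) * depth v (D m')
        + (\<Sum>r\<in>R - D m'. depth v (cluster_wedge v f r (D m')))"
        using sum sumC by (simp add: R_def[symmetric] dS)
      show ?thesis unfolding integral_pair_def R_def[symmetric]
        by (rule disjI2, rule bexI[of _ "D m'"], intro conjI exI[of _ "D m"])
           (use True child c1 D_cl[OF Sne] D_stable m0 m'm dS le in auto)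
    qed
  qed
qed

text \<open>A rational centre of \<open>t\<close>, or of \<open>s\<close> if \<open>t = {}\<close>, is the required translation.\<close>

lemma sum_nonneg_if_integral_pair:
  assumes f: "f \<noteq> 0" and card: "card (roots_of f) > 1"
    and stable: "G_stable (galois_group K) (roots_of f)"
    and center: "\<And>T d. T \<subseteq> roots_of f \<Longrightarrow> T \<noteq> {} \<Longrightarrow> G_stable (galois_group K) T \<Longrightarrow>
      (\<And>a b. a \<in> T \<Longrightarrow> b \<in> T \<Longrightarrow> ereal d \<le> v (a - b)) \<Longrightarrow> \<exists>z\<in>K. \<forall>r\<in>T. ereal d \<le> v (r - z)"
    and pair: "integral_pair K v f n"
  shows "\<exists>z\<in>K. 0 \<le> n + (\<Sum>r\<in>roots_of f. vneg (r - z))"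
proof -
  define R where "R = roots_of f"
  have fin: "finite R" unfolding R_def roots_of_def by (rule poly_roots_finite[OF f])
  from pair consider
    (all) "0 \<le> n" "0 \<le> depth v R" |
    (cluster) s t where "s \<in> clusters v f" "1 < card s" "G_stable (galois_group K) s" "depth v s \<le> 0"
      "t = {} \<or> (is_child v f t s \<and> G_stable (galois_group K) t \<and> (card t = 1 \<or> 0 \<le> depth v t))"
      "0 \<le> n + (real (card s) - real (card t)) * depth v s
         + (\<Sum>r\<in>R - s. depth v (cluster_wedge v f r s))"
    unfolding integral_pair_def R_def by blast
  then show ?thesis
  proof cases
    case all
    have "ereal 0 \<le> v (a - b)" if "a \<in> R" "b \<in> R" for a b
      using depth_le[OF fin _ that] card all(2) R_def by (meson ereal_less_eq(3) order_trans)
    then obtain z where z: "z \<in> K" "\<And>r. r \<in> R \<Longrightarrow> ereal 0 \<le> v (r - z)"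
      using center[of R 0] stable card R_def by (metis card.empty not_less_zero order_refl)
    have "0 \<le> (\<Sum>r\<in>R. vneg (r - z))" using z(2) by (intro sum_nonneg) (simp add: vneg_ge_iff)
    then show ?thesis using z(1) all(1) R_def by (intro bexI[of _ z]) auto
  next
    case cluster
    have sR: "s \<subseteq> R" using clustersD(2)[OF cluster(1)] R_def by simp
    then have sfin: "finite s" using fin finite_subset by blast
    have ts: "t \<subseteq> s" using cluster(5) by (auto simp: is_child_def)
    let ?d = "depth v s"
    have ds: "ereal ?d \<le> v (a - b)" if "a \<in> s" "b \<in> s" for a b by (rule depth_le[OF sfin cluster(2) that])
    \<comment> \<open>Centring at \<open>t\<close> costs nothing for \<open>s\<close>: since
      \<open>depth v s \<le> 0\<close>, a root of \<open>t\<close> at valuation at least 0 from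
      \<open>z\<close> is also close enough to serve as \<open>r0\<close>.\<close>
    have "\<exists>z\<in>K. (\<forall>r\<in>t. ereal 0 \<le> v (r - z)) \<and> (\<exists>r0\<in>s. ereal ?d \<le> v (r0 - z))"
    proof (cases "t = {}")
      case True
      have "s \<noteq> {}" using cluster(2) by auto
      then show ?thesis using center[of s ?d] cluster(3) ds sR R_def True by blast
    next
      case False
      have t: "G_stable (galois_group K) t" "card t = 1 \<or> 0 \<le> depth v t" using cluster(5) False by auto
      have tfin: "finite t" using ts sfin finite_subset by blast
      have "ereal 0 \<le> v (a - b)" if "a \<in> t" "b \<in> t" for a b
      proof (cases "card t = 1")
        case True
        then have "a = b" using that by (auto simp: card_1_singleton_iff)
        then show ?thesis by simp
      next
        case False
        then have "0 \<le> depth v t" "card t > 1" using t(2) that tfin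
          by (auto simp: card_gt_0_iff) (metis One_nat_def Suc_lessI card_gt_0_iff empty_iff)
        then show ?thesis using depth_le[OF tfin _ that] by (meson ereal_less_eq(3) order_trans)
      qed
      then obtain z where z: "z \<in> K" "\<forall>r\<in>t. ereal 0 \<le> v (r - z)"
        using center[of t 0] t(1) ts sR R_def False by blast
      moreover obtain r0 where "r0 \<in> t" using False by blast
      ultimately show ?thesis using ts cluster(4) by (meson ereal_less_eq(3) order_trans subsetD)
    qed
    then obtain z r0 where z: "z \<in> K" "\<And>r. r \<in> t \<Longrightarrow> ereal 0 \<le> v (r - z)" "r0 \<in> s" "ereal ?d \<le> v (r0 - z)"
      by blast
    \<comment> \<open>\<open>\<beta> r\<close> is the share of \<open>r\<close> in the integrality
      inequality, so it suffices to bound it by the Gauss term root by root.\<close>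
    define \<beta> where "\<beta> r = (if r \<in> t then 0 else if r \<in> s then ?d else depth v (cluster_wedge v f r s))" for r
    have "\<beta> r \<le> vneg (r - z)" if r: "r \<in> R" for r
    proof -
      consider "r \<in> t" | "r \<in> s - t" | "r \<in> R - s" using r by blast
      then show ?thesis
      proof cases
        case 1
        then show ?thesis using z(2) by (simp add: \<beta>_def vneg_ge_iff)
      next
        case 2
        then have "ereal ?d \<le> v (r - z)" using ds z(3,4) v_triangle_le by blast
        then show ?thesis using 2 cluster(4) by (simp add: \<beta>_def vneg_ge_iff)
      next
        case 3
        let ?w = "depth v (cluster_wedge v f r s)"
        have w: "ereal ?w = v (r - r0)"
          using depth_wedge[OF f cluster(1) z(3)] 3 R_def by simp
        obtain a b where ab: "a \<in> s" "b \<in> s" "ereal ?d = v (a - b)"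
          using depth_attained[OF sfin cluster(2)] by blast
        have "v (r - r0) < v (a - b)"
          using v_outside_cluster[OF f cluster(1) z(3), of r] 3 ab v_diff_commute[of r0 b] R_def
          by (intro v_triangle_less[of _ a r0 b]) auto
        \<comment> \<open>This serves twice: together with \<open>depth v s \<le> 0\<close> it makes
          \<open>?w\<close> negative, and it puts \<open>z\<close> at valuation at least
          \<open>?w\<close> from \<open>r0\<close>.\<close>
        then have wd: "?w < ?d" using w ab(3) by (metis less_ereal.simps(1))
        have "ereal ?w \<le> v (r - z)"
        proof (rule v_triangle_le[of _ r r0 z])
          have "ereal ?w \<le> ereal ?d" using wd by simp
          then show "ereal ?w \<le> v (r0 - z)" using z(4) by (rule order_trans)
        qed (simp add: w)
        then show ?thesis using 3 ts wd cluster(4) by (auto simp: \<beta>_def vneg_ge_iff)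
      qed
    qed
    then have "(\<Sum>r\<in>R. \<beta> r) \<le> (\<Sum>r\<in>R. vneg (r - z))" by (rule sum_mono)
    moreover have "(\<Sum>r\<in>R. \<beta> r) = (\<Sum>r\<in>R - s. \<beta> r) + ((\<Sum>r\<in>s - t. \<beta> r) + (\<Sum>r\<in>t. \<beta> r))"
      using sum.subset_diff[OF sR fin, of \<beta>] sum.subset_diff[OF ts sfin, of \<beta>] by simp
    moreover have "(\<Sum>r\<in>t. \<beta> r) = 0" by (simp add: \<beta>_def)
    moreover have "(\<Sum>r\<in>s - t. \<beta> r) = (\<Sum>r\<in>s - t. ?d)" by (intro sum.cong) (auto simp: \<beta>_def)
    moreover have "real (card (s - t)) = real (card s) - real (card t)"
      using ts sfin finite_subset[OF ts sfin] by (subst card_Diff_subset) (auto simp: card_mono of_nat_diff)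
    moreover have "(\<Sum>r\<in>R - s. \<beta> r) = (\<Sum>r\<in>R - s. depth v (cluster_wedge v f r s))"
      using ts by (intro sum.cong) (auto simp: \<beta>_def)
    ultimately have "0 \<le> n + (\<Sum>r\<in>R. vneg (r - z))" using cluster(6) by simp
    then show ?thesis using z(1) R_def by blast
  qed
qed

end

subsection \<open>The integrality criterion\<close>

lemma local_closure_absv:
  fixes K :: "'a::field set"
  assumes K: "nonarch_local_field K v" and p: "residue_char v p"
    and ac: "alg_closed_field TYPE('a)" and alg: "algebraic_over K"
  shows "local_closure (absv v) K p"
proof -
  interpret valuation v using K by unfold_locales (simp add: nonarch_local_field_def)
  show ?thesis
  proof (intro local_closure.intro complete_subfield.intro nonarch_abs_absv
      complete_subfield_axioms.intro local_closure_axioms.intro)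
    show "is_subfield K" using K by (simp add: nonarch_local_field_def)
    show "alg_closed_field TYPE('a)" "algebraic_over K" by (fact ac alg)+
    show "prime p" "absv v (of_nat p) < 1" using p by (auto simp: residue_char_def absv_less_1_iff)
  next
    fix x :: "nat \<Rightarrow> 'a"
    assume x: "\<And>n. x n \<in> K" and Cauchy: "\<And>e. e > 0 \<Longrightarrow> \<exists>M. \<forall>m\<ge>M. \<forall>n\<ge>M. absv v (x m - x n) < e"
    have "\<exists>N. \<forall>m\<ge>N. \<forall>n\<ge>N. ereal M \<le> v (x m - x n)" for M :: real
    proof -
      obtain N where "\<forall>m\<ge>N. \<forall>n\<ge>N. absv v (x m - x n) < 2 powr (- M)"
        using Cauchy[of "2 powr (- M)"] by auto
      then show ?thesis by (intro exI[of _ N]) (auto simp flip: absv_le_powr_iff intro: less_imp_le)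
    qed
    then obtain l where l: "l \<in> K" "\<And>M::real. \<exists>N. \<forall>n\<ge>N. ereal M \<le> v (x n - l)"
      using K x unfolding nonarch_local_field_def by metis
    have "\<forall>\<^sub>F n in sequentially. absv v (x n - l) < e" if "e > 0" for e
    proof -
      \<comment> \<open>The bound amounts to \<open>e / 2\<close>, which turns the weak inequality
        into a strict one below \<open>e\<close>.\<close>
      obtain N where "\<forall>n\<ge>N. absv v (x n - l) \<le> 2 powr (- (- log 2 (e / 2)))"
        using l(2) unfolding absv_le_powr_iff by blast
      then have "absv v (x n - l) < e" if "n \<ge> N" for n using that \<open>e > 0\<close> by force
      then show ?thesis unfolding eventually_sequentially by blast
    qed
    with l(1) show "\<exists>l\<in>K. \<forall>e>0. \<forall>\<^sub>F n in sequentially. absv v (x n - l) < e" by blast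
  next
    fix x y assume xy: "x \<in> K" "y \<in> K" "absv v x < absv v y"
    show "absv v x \<le> absv v y / 2"
    proof (cases "x = 0")
      case True
      then show ?thesis using abs.N_nonneg[of y] by simp
    next
      case False
      have y0: "y \<noteq> 0" using xy(3) abs.N_nonneg[of x] by (metis abs.N_0 not_less)
      obtain a b :: int where ab: "v x = ereal (of_int a)" "v y = ereal (of_int b)"
        using K xy(1,2) False y0 unfolding nonarch_local_field_def by meson
      have N: "absv v x = 2 powr (- of_int a)" "absv v y = 2 powr (- of_int b)"
        using ab False y0 by (auto simp: absv_def)
      have "b < a" using xy(3) ab by (simp add: absv_less_iff)
      then have "- real_of_int a \<le> - real_of_int b - 1" by linarith
      then have "absv v x \<le> 2 powr (- real_of_int b - 1)" unfolding N(1) by simp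
      also have "\<dots> = absv v y / 2" unfolding N(2) by (simp add: powr_diff)
      finally show ?thesis .
    qed
  next
    show "\<exists>S. finite S \<and> (\<forall>a\<in>K. absv v a \<le> 1 \<longrightarrow> (\<exists>s\<in>S. absv v (a - s) < 1))"
      using K unfolding nonarch_local_field_def absv_le_1_iff absv_less_1_iff by meson
  qed
qed

lemma rsquarefree_not_square_dvd:
  assumes "rsquarefree f"
  shows "\<not> [:- a, 1:] ^ 2 dvd f"
proof -
  have "f \<noteq> 0" "order a f = 0 \<or> order a f = 1" using assms unfolding rsquarefree_def by blast+
  then show ?thesis by (auto simp: order_divides)
qed

lemma rsquarefree_splits:
  fixes f :: "'a::field poly"
  assumes ac: "alg_closed_field TYPE('a)" and f: "rsquarefree f"
  shows "f = smult (lead_coeff f) (\<Prod>r\<in>roots_of f. [:- r, 1:])" "card (roots_of f) = degree f"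
proof -
  obtain xs where xs: "length xs = degree f" "f = smult (lead_coeff f) (\<Prod>x\<leftarrow>xs. [:- x, 1:])"
    using alg_closed_splits[OF ac, of f] by blast
  have lc: "lead_coeff f \<noteq> 0" using f by (simp add: rsquarefree_def)
  have "distinct xs"
  proof (rule ccontr)
    assume "\<not> distinct xs"
    then obtain as bs cs y where "xs = as @ [y] @ bs @ [y] @ cs" using not_distinct_decomp by blast
    then have "(\<Prod>x\<leftarrow>xs. [:- x, 1:]) =
      [:- y, 1:] ^ 2 * ((\<Prod>x\<leftarrow>as. [:- x, 1:]) * (\<Prod>x\<leftarrow>bs. [:- x, 1:]) * (\<Prod>x\<leftarrow>cs. [:- x, 1:]))"
      by (simp only: map_append prod_list.append list.map prod_list.Cons prod_list.Nil power2_eq_square mult_ac mult_1)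
    then have "[:- y, 1:] ^ 2 dvd (\<Prod>x\<leftarrow>xs. [:- x, 1:])" by (metis dvd_triv_left)
    then have "[:- y, 1:] ^ 2 dvd f" by (subst xs(2)) (rule dvd_smult)
    then show False using rsquarefree_not_square_dvd[OF f] by blast
  qed
  moreover have "roots_of f = set xs"
  proof -
    have "poly f x = 0 \<longleftrightarrow> x \<in> set xs" for x
      by (subst xs(2)) (use lc in \<open>simp add: poly_prod_list_linear_0_iff\<close>)
    then show ?thesis by (auto simp: roots_of_def)
  qed
  ultimately show "card (roots_of f) = degree f" "f = smult (lead_coeff f) (\<Prod>r\<in>roots_of f. [:- r, 1:])"
    using xs distinct_card[of xs] prod.distinct_set_conv_list[of xs "\<lambda>x. [:- x, 1:]"] by auto
qed

theorem theorem13p3: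
  fixes K :: "'a::field set" and v :: "'a \<Rightarrow> ereal" and p :: nat
    and f :: "'a poly" and g :: nat
  assumes "nonarch_local_field K v"
    and "residue_char v p" and "p \<noteq> 2"
    and "alg_closed_field TYPE('a)" and "algebraic_over K"
    and "\<forall>i. coeff f i \<in> K"
    and "rsquarefree f"
    and "2 \<le> g" and "degree f = 2 * g + 1 \<or> degree f = 2 * g + 2"
  shows "(integral_poly v f \<longrightarrow> integral_pair K v f (real_of_ereal (v (lead_coeff f)))) \<and>
         (integral_pair K v f (real_of_ereal (v (lead_coeff f))) \<and> acts_tamely K v (roots_of f)
            \<longrightarrow> (\<exists>z\<in>K. integral_poly v (f \<circ>\<^sub>p [:- z, 1:])))"
proof -
  interpret valuation v using assms(1) by unfold_locales (simp add: nonarch_local_field_def)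
  interpret LC: local_closure "absv v" K p using assms(1,2,4,5) by (rule local_closure_absv)
  define R where "R = roots_of f"
  define c where "c = lead_coeff f"
  have f0: "f \<noteq> 0" using assms(7) by (simp add: rsquarefree_def)
  have c0: "c \<noteq> 0" using f0 by (simp add: c_def)
  have fK: "f \<in> polys_over K" using assms(6) by (simp add: polys_over_def)
  have fin: "finite R" unfolding R_def roots_of_def by (rule poly_roots_finite[OF f0])
  have f_eq: "f = smult c (\<Prod>r\<in>R. [:- r, 1:])" and cardR: "card R > 1"
    using rsquarefree_splits[OF assms(4,7)] assms(8,9) unfolding c_def R_def by auto
  have inv: "v (\<sigma> x) = v x" if "\<sigma> \<in> galois_group K" for \<sigma> x
    using LC.galois_N[OF that, of x] absv_le_iff[of x "\<sigma> x"] absv_le_iff[of "\<sigma> x" x] by simp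
  have stable: "G_stable (galois_group K) R" unfolding G_stable_def
  proof
    fix \<sigma> assume \<sigma>: "\<sigma> \<in> galois_group K"
    have "\<sigma> ` R \<subseteq> R"
      using galois_group_poly[OF \<sigma> fK] galois_group_0[OF \<sigma>] by (auto simp: R_def roots_of_def) (metis)
    then show "\<sigma> ` R = R"
      using fin galois_groupD(4)[OF \<sigma>] by (intro endo_inj_surj) (auto intro: inj_on_subset)
  qed
  show ?thesis
  proof (intro conjI impI)
    assume "integral_poly v f"
    then have "0 \<le> real_of_ereal (v c) + (\<Sum>r\<in>R. vneg r)"
      using integral_prod_linear_iff[OF fin c0, of "\<lambda>r. r"] f_eq by simp
    then show "integral_pair K v f (real_of_ereal (v (lead_coeff f)))"
      unfolding c_def[symmetric] using cardR R_def by (intro integral_pair_if_sum_nonneg f0 fK inv) auto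
  next
    assume asm: "integral_pair K v f (real_of_ereal (v (lead_coeff f))) \<and> acts_tamely K v (roots_of f)"
    \<comment> \<open>A root outside \<open>L\<close> would, being separable, be moved by an
      automorphism over \<open>L\<close>. By \<open>wild\<close> this automorphism belongs to wild
      inertia over \<open>K\<close>, which fixes all roots.\<close>
    have tame: "LC.tame r" if r: "r \<in> R" for r
      unfolding LC.tame_def
    proof (intro allI impI, rule ccontr)
      fix L assume L: "is_subfield L" "K \<subseteq> L" "r \<notin> L"
        and wild: "\<forall>\<sigma>\<in>galois_group L. \<forall>x. x \<noteq> 0 \<longrightarrow> absv v (\<sigma> x - x) < absv v x"
      have "poly f r = 0" using r by (simp add: R_def roots_of_def)
      then obtain h where h: "f = [:- r, 1:] * h" by (auto simp: poly_eq_0_iff_dvd)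
      have "poly h r \<noteq> 0"
      proof
        assume "poly h r = 0"
        then have "[:- r, 1:] dvd h" by (simp add: poly_eq_0_iff_dvd)
        then have "[:- r, 1:] ^ 2 dvd f" unfolding h power2_eq_square by (intro mult_dvd_mono) auto
        then show False using rsquarefree_not_square_dvd[OF assms(7)] by blast
      qed
      then obtain \<sigma> where \<sigma>: "\<sigma> \<in> galois_group L" "\<sigma> r \<noteq> r"
        using separable_moved[OF assms(4) LC.subfield assms(5) L(1,2) fK h _ L(3)] by blast
      then have "\<sigma> \<in> wild_inertia K v"
        using wild galois_group_antimono[OF L(2)] by (auto simp: wild_inertia_def absv_less_iff)
      then show False using asm \<sigma>(2) r by (auto simp: acts_tamely_def R_def)
    qed
    have "\<exists>z\<in>K. 0 \<le> real_of_ereal (v c) + (\<Sum>r\<in>roots_of f. vneg (r - z))"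
    proof (rule sum_nonneg_if_integral_pair[OF f0])
      fix T and d :: real
      assume T: "T \<subseteq> roots_of f" "T \<noteq> {}" "G_stable (galois_group K) T"
        and d: "\<And>a b. a \<in> T \<Longrightarrow> b \<in> T \<Longrightarrow> ereal d \<le> v (a - b)"
      obtain r where r: "r \<in> T" using T(2) by blast
      have "absv v (\<sigma> r - r) \<le> 2 powr (- d)" if "\<sigma> \<in> galois_group K" for \<sigma>
      proof -
        have "\<sigma> r \<in> T" using T(3) r that by (auto simp: G_stable_def)
        then show ?thesis using d r by (simp add: absv_le_powr_iff)
      qed
      \<comment> \<open>A centre for one root serves all of \<open>T\<close>, because the other
        roots of \<open>T\<close> lie at valuation at least \<open>d\<close> from it.\<close>
      then obtain z where z: "z \<in> K" "absv v (r - z) \<le> 2 powr (- d)"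
        using LC.tame_center[of r "2 powr (- d)"] tame[of r] r T(1) R_def by auto
      then have "ereal d \<le> v (r' - z)" if "r' \<in> T" for r'
        using d[OF that r] by (intro v_triangle_le[of _ r' r z]) (auto simp: absv_le_powr_iff)
      then show "\<exists>z\<in>K. \<forall>r\<in>T. ereal d \<le> v (r - z)" using z(1) by blast
    qed (use asm cardR stable R_def c_def in auto)
    then obtain z where z: "z \<in> K" "0 \<le> real_of_ereal (v c) + (\<Sum>r\<in>R. vneg (r - z))" unfolding R_def by blast
    \<comment> \<open>Roots \<open>r - z\<close> belong to the polynomial with argument
      \<open>x + z\<close>, so the required translation is by \<open>- z\<close>.\<close>
    have "f \<circ>\<^sub>p [:- (- z), 1:] = smult c (\<Prod>r\<in>R. [:- (r - z), 1:])"
      by (subst f_eq) (simp add: pcompose_smult pcompose_prod pcompose_pCons)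
    then have "integral_poly v (f \<circ>\<^sub>p [:- (- z), 1:])"
      using integral_prod_linear_iff[OF fin c0, of "\<lambda>r. r - z"] z(2) by simp
    then show "\<exists>z\<in>K. integral_poly v (f \<circ>\<^sub>p [:- z, 1:])"
      using subfield_minus[OF LC.subfield z(1)] by blast
  qed
qed

end
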